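(* Let $a,b,c,d$ be positive integers with $b>1$, $d>1$ and $a(b-1)=c(d-1)=:N$, and let $f=P(a,b,c,d)$ be the permutation of $\mathbb{N}_0$ defined below. Then for every positive integer $m$, $f$ has only finitely many $m$-cycles, and these $m$-cycles can be computed (there is an algorithm which, given $a,b,c,d,m$, outputs all $m$-cycles of $f$).
   Context: $\mathbb{N}_0=\{0,1,2,\dots\}$. Let $r_1<r_2<\dots<r_N$ be the elements of $\{1,\dots,ab-1\}$ not divisible by $b$, and $s_1<\dots<s_N$ the elements of $\{1,\dots,cd-1\}$ not divisible by $d$. The map $P(a,b,c,d):\mathbb{N}_0\to\mathbb{N}_0$ is defined for $n\in\mathbb{N}_0$ by $f(bn)=dn$ and $f(abn+r_i)=cdn+s_i$ for $i=1,\dots,N$; it is a bijection. A cycle of $f$ is a finite sequence of distinct elements $x_0,\dots,x_{p-1}$ with $f(x_i)=x_{i+1}$ (indices mod $p$). An $m$-cycle is a cycle which, read cyclically, has exactly $m$ local minima and $m$ local maxima (an element $x_i$ is a local minimum if $x_{i-1}>x_i<x_{i+1}$ and a local maximum if $x_{i-1}<x_i>x_{i+1}$, indices mod $p$). *)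

theory Defs
  imports Complex_Main "HOL-Library.Nat_Bijection"
begin

section \<open>The permutation \<open>P(a,b,c,d)\<close>\<close>

text \<open>
  \<open>nonmultiples a b\<close> is the increasing list \<open>r\<^sub>1 < \<dots> < r\<^sub>N\<close>, so \<open>r\<^sub>i\<close> is
  \<open>nonmultiples a b ! (i - 1)\<close>; likewise \<open>nonmultiples c d\<close> is \<open>s\<^sub>1 < \<dots> < s\<^sub>N\<close>.
\<close>

definition nonmultiples :: "nat \<Rightarrow> nat \<Rightarrow> nat list" where
  "nonmultiples a b = filter (\<lambda>r. \<not> b dvd r) [1..<a * b]"

text \<open>
  The index of \<open>r = x mod (a * b)\<close> in \<open>nonmultiples a b\<close> is the number of
  non-multiples of \<open>b\<close> in \<open>{1..<r}\<close>. The equations \<open>f(bn) = dn\<close> and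
  \<open>f(abn + r\<^sub>i) = cdn + s\<^sub>i\<close> are the lemmas \<open>P_map_mult\<close> and \<open>P_map_nonmult\<close>; by
  \<open>P_map_unique\<close> they determine the map.
\<close>

definition P_map :: "nat \<Rightarrow> nat \<Rightarrow> nat \<Rightarrow> nat \<Rightarrow> nat \<Rightarrow> nat" where
  "P_map a b c d x =
    (if b dvd x then d * (x div b)
     else c * d * (x div (a * b)) +
       nonmultiples c d ! length (filter (\<lambda>r. \<not> b dvd r) [1..<x mod (a * b)]))"

lemma set_nonmultiples: "set (nonmultiples a b) = {r \<in> {1..<a * b}. \<not> b dvd r}"
  by (auto simp: nonmultiples_def)

lemma sorted_nonmultiples: "sorted_wrt (<) (nonmultiples a b)"
  by (simp add: nonmultiples_def sorted_wrt_filter)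

lemma length_nonmultiples:
  assumes "b > 0"
  shows "length (nonmultiples a b) = a * (b - 1)"
proof (induction a)
  case 0
  show ?case by (simp add: nonmultiples_def)
next
  case (Suc a)
  have len: "length (nonmultiples k b) = card {r \<in> {0..<k * b}. \<not> b dvd r}" for k
  proof -
    have "distinct (nonmultiples k b)" by (simp add: nonmultiples_def)
    then have "length (nonmultiples k b) = card (set (nonmultiples k b))"
      by (simp add: distinct_card)
    also have "set (nonmultiples k b) = {r \<in> {0..<k * b}. \<not> b dvd r}"
      unfolding set_nonmultiples by (auto intro: Suc_leI gr0I)
    finally show ?thesis .
  qed
  have "{r \<in> {0..<Suc a * b}. \<not> b dvd r}
      = {r \<in> {0..<a * b}. \<not> b dvd r} \<union> {a * b<..<Suc a * b}"
  proof (intro equalityI subsetI)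
    fix r assume r: "r \<in> {r \<in> {0..<Suc a * b}. \<not> b dvd r}"
    then have "r \<noteq> a * b" by auto
    with r show "r \<in> {r \<in> {0..<a * b}. \<not> b dvd r} \<union> {a * b<..<Suc a * b}"
      by auto
  next
    fix r assume r: "r \<in> {r \<in> {0..<a * b}. \<not> b dvd r} \<union> {a * b<..<Suc a * b}"
    have "\<not> b dvd r" if "a * b < r" "r < Suc a * b"
    proof
      assume "b dvd r"
      then obtain k where "r = b * k" by (rule dvdE)
      with that have "a < k \<and> k < Suc a" by (simp only: mult.commute[of b] mult_less_cancel2)
      then show False by arith
    qed
    with r show "r \<in> {r \<in> {0..<Suc a * b}. \<not> b dvd r}" by auto
  qed
  then have "card {r \<in> {0..<Suc a * b}. \<not> b dvd r}
      = card {r \<in> {0..<a * b}. \<not> b dvd r} + (b - 1)"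
    using assms by (simp add: card_Un_disjoint disjoint_iff)
  with Suc.IH show ?case unfolding len by simp
qed

lemma nonmultiples_index:
  assumes "i < length (nonmultiples a b)"
  shows "length (filter (\<lambda>r. \<not> b dvd r) [1..<nonmultiples a b ! i]) = i"
proof -
  obtain r where r_def: "nonmultiples a b ! i = r" by simp
  have r: "r \<in> {r \<in> {1..<a * b}. \<not> b dvd r}"
    using nth_mem[OF assms] by (simp only: set_nonmultiples r_def)
  then have le: "1 \<le> r" "r < a * b" by auto
  have "[1..<a * b] = [1..<r] @ [r..<a * b]"
    using upt_add_eq_append[OF le(1), of "a * b - r"] le(2) by simp
  also have "[r..<a * b] = r # [Suc r..<a * b]"
    by (rule upt_conv_Cons[OF le(2)])
  finally have split: "nonmultiples a b = filter (\<lambda>r. \<not> b dvd r) [1..<r]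
      @ r # filter (\<lambda>r. \<not> b dvd r) [Suc r..<a * b]" (is "_ = ?l @ _ # ?u")
    using r unfolding nonmultiples_def by simp
  have nth: "nonmultiples a b ! length ?l = r"
    unfolding split by (rule nth_append_length)
  have less: "length ?l < length (nonmultiples a b)"
    unfolding split by simp
  have "distinct (nonmultiples a b)" by (simp add: nonmultiples_def)
  then have "length ?l = i"
    using nth_eq_iff_index_eq[OF _ less assms] nth r_def by simp
  then show ?thesis unfolding r_def .
qed

lemma P_map_mult:
  assumes "b > 0"
  shows "P_map a b c d (b * n) = d * n"
  using assms by (simp add: P_map_def)

lemma P_map_nonmult:
  assumes "i < length (nonmultiples a b)"
  shows "P_map a b c d (a * b * n + nonmultiples a b ! i) = c * d * n + nonmultiples c d ! i"
proof -
  have r: "nonmultiples a b ! i \<in> {r \<in> {1..<a * b}. \<not> b dvd r}"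
    using nth_mem[OF assms] by (simp only: set_nonmultiples)
  then have "\<not> b dvd a * b * n + nonmultiples a b ! i"
    by (simp add: dvd_add_right_iff)
  moreover have "(a * b * n + nonmultiples a b ! i) div (a * b) = n"
    "(a * b * n + nonmultiples a b ! i) mod (a * b) = nonmultiples a b ! i"
    using r by (auto simp: div_add1_eq)
  ultimately show ?thesis
    using nonmultiples_index[OF assms] by (simp add: P_map_def)
qed

lemma nonmult_cases:
  assumes "a > 0" "b > 0"
  obtains n where "x = b * n"
  | n i where "i < length (nonmultiples a b)" "x = a * b * n + nonmultiples a b ! i"
proof (cases "b dvd x")
  case True
  then show ?thesis using that(1) by (auto elim: dvdE)
next
  case False
  then have "\<not> b dvd x mod (a * b)" by (simp add: dvd_mod_iff)
  moreover from this have "x mod (a * b) \<noteq> 0" by (intro notI) simp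
  moreover have "x mod (a * b) < a * b" using assms by simp
  ultimately have "x mod (a * b) \<in> set (nonmultiples a b)"
    unfolding set_nonmultiples by simp
  then obtain i where "i < length (nonmultiples a b)" "nonmultiples a b ! i = x mod (a * b)"
    by (auto simp: in_set_conv_nth)
  then show ?thesis using that(2)[of i "x div (a * b)"] by simp
qed

lemma P_map_unique:
  assumes "a > 0" "b > 0"
    and "\<And>n. f (b * n) = d * n"
    and "\<And>n i. i < length (nonmultiples a b) \<Longrightarrow>
      f (a * b * n + nonmultiples a b ! i) = c * d * n + nonmultiples c d ! i"
  shows "f = P_map a b c d"
proof
  fix x
  show "f x = P_map a b c d x"
    by (rule nonmult_cases[OF assms(1,2), of x]) (simp_all add: assms P_map_mult P_map_nonmult)
qed

lemma P_map_inverse: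
  assumes "a > 0" "b > 0" "d > 0" "a * (b - 1) = c * (d - 1)"
  shows "P_map c d a b (P_map a b c d x) = x"
proof (rule nonmult_cases[OF assms(1,2), of x])
  fix n i assume "i < length (nonmultiples a b)" "x = a * b * n + nonmultiples a b ! i"
  moreover from this have "i < length (nonmultiples c d)"
    using assms by (simp add: length_nonmultiples)
  ultimately show ?thesis by (simp add: P_map_nonmult)
qed (use assms in \<open>simp add: P_map_mult\<close>)

lemma bij_P_map:
  assumes "a > 0" "b > 0" "c > 0" "d > 0" "a * (b - 1) = c * (d - 1)"
  shows "bij (P_map a b c d)"
  using assms by (intro o_bij[of "P_map c d a b"] ext) (simp_all add: P_map_inverse)

section \<open>Cycles\<close>

definition is_cycle :: "(nat \<Rightarrow> nat) \<Rightarrow> nat list \<Rightarrow> bool" where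
  "is_cycle f xs \<longleftrightarrow> xs \<noteq> [] \<and> distinct xs \<and>
    (\<forall>i<length xs. f (xs ! i) = xs ! ((i + 1) mod length xs))"

definition local_minima :: "nat list \<Rightarrow> nat set" where
  "local_minima xs = {i. i < length xs \<and>
    xs ! ((i + length xs - 1) mod length xs) > xs ! i \<and>
    xs ! i < xs ! ((i + 1) mod length xs)}"

definition local_maxima :: "nat list \<Rightarrow> nat set" where
  "local_maxima xs = {i. i < length xs \<and>
    xs ! ((i + length xs - 1) mod length xs) < xs ! i \<and>
    xs ! i > xs ! ((i + 1) mod length xs)}"

definition m_cycles :: "(nat \<Rightarrow> nat) \<Rightarrow> nat \<Rightarrow> nat list set" where
  "m_cycles f m = {xs. is_cycle f xs \<and>
    card (local_minima xs) = m \<and> card (local_maxima xs) = m}"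

section \<open>Algorithms\<close>

text \<open>
  An algorithm is a program for a partial recursive function:
  \<open>rec_eval p xs y\<close> means that the program \<open>p\<close> halts on the argument tuple \<open>xs\<close>
  with output \<open>y\<close>. Lists are passed as numbers via \<open>list_encode\<close>.
\<close>

datatype recf =
    Zero
  | Succ
  | Proj nat
  | Comp recf "recf list"
  | PrimRec recf recf
  | Mu recf

inductive rec_eval :: "recf \<Rightarrow> nat list \<Rightarrow> nat \<Rightarrow> bool" where
  zero: "rec_eval Zero xs 0"
| succ: "rec_eval Succ [x] (Suc x)"
| proj: "i < length xs \<Longrightarrow> rec_eval (Proj i) xs (xs ! i)"
| comp: "\<lbrakk>list_all2 (\<lambda>g y. rec_eval g xs y) gs ys; rec_eval f ys z\<rbrakk>
    \<Longrightarrow> rec_eval (Comp f gs) xs z"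
| prim_zero: "rec_eval f xs y \<Longrightarrow> rec_eval (PrimRec f g) (0 # xs) y"
| prim_succ: "\<lbrakk>rec_eval (PrimRec f g) (n # xs) y; rec_eval g (n # y # xs) z\<rbrakk>
    \<Longrightarrow> rec_eval (PrimRec f g) (Suc n # xs) z"
| mu: "\<lbrakk>rec_eval f (n # xs) 0; \<And>k. k < n \<Longrightarrow> \<exists>y. rec_eval f (k # xs) (Suc y)\<rbrakk>
    \<Longrightarrow> rec_eval (Mu f) xs n"

inductive_cases rec_eval_ZeroE: "rec_eval Zero xs y"
inductive_cases rec_eval_SuccE: "rec_eval Succ xs y"
inductive_cases rec_eval_ProjE: "rec_eval (Proj i) xs y"
inductive_cases rec_eval_CompE: "rec_eval (Comp f gs) xs y"
inductive_cases rec_eval_PrimRec0E: "rec_eval (PrimRec f g) (0 # xs) y"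
inductive_cases rec_eval_PrimRecSucE: "rec_eval (PrimRec f g) (Suc n # xs) y"
inductive_cases rec_eval_MuE: "rec_eval (Mu f) xs y"

lemma rec_eval_deterministic:
  "rec_eval p xs y \<Longrightarrow> rec_eval p xs y' \<Longrightarrow> y = y'"
proof (induction arbitrary: y' rule: rec_eval.induct)
  case (zero xs)
  then show ?case by (rule rec_eval_ZeroE) simp
next
  case (succ x)
  then show ?case by (auto elim: rec_eval_SuccE)
next
  case (proj i xs)
  then show ?case by (auto elim: rec_eval_ProjE)
next
  case (comp xs gs ys f z)
  from comp.prems obtain ys' where ys': "list_all2 (\<lambda>g y. rec_eval g xs y) gs ys'"
    "rec_eval f ys' y'" by (rule rec_eval_CompE)
  have "ys = ys'"
    using comp.IH(1) ys'(1) by (auto simp: list_all2_conv_all_nth intro: nth_equalityI)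
  with ys' comp.IH(2) show ?case by simp
next
  case (prim_zero f xs y g)
  from prim_zero.prems have "rec_eval f xs y'" by (rule rec_eval_PrimRec0E)
  then show ?case by (rule prim_zero.IH)
next
  case (prim_succ f g n xs y z)
  from prim_succ.prems obtain v where "rec_eval (PrimRec f g) (n # xs) v"
    "rec_eval g (n # v # xs) y'" by (rule rec_eval_PrimRecSucE)
  with prim_succ.IH show ?case by metis
next
  case (mu f n xs)
  from mu.prems have n': "rec_eval f (y' # xs) 0"
    "\<And>k. k < y' \<Longrightarrow> \<exists>y. rec_eval f (k # xs) (Suc y)" by (blast elim: rec_eval_MuE)+
  show ?case
  proof (cases n y' rule: linorder_cases)
    case less
    with n'(2) mu.IH(1) show ?thesis by blast
  next
    case greater
    with mu.IH(2) n'(1) show ?thesis by blast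
  qed
qed

end

theory Submission
  imports Defs "Jordan_Normal_Form.Determinant"
begin

text \<open>
  Along a cycle the multiples of \<open>b\<close> are multiplied exactly by \<open>d / b\<close> and the other elements
  by \<open>\<rho> = d (b - 1) / (b (d - 1))\<close> up to an error of at most 1. By passing to the inverse map
  assume \<open>b < d\<close>, so that the former steps increase and the latter decrease. If \<open>X\<close> is
  the least element, \<open>K\<close> the number of exact steps and \<open>L\<close> the number of the others, then
  \<open>\<bar>K ln (d / b) + L ln \<rho>\<bar> \<le> 2 L / X\<close>, while an increasing run of length \<open>k\<close> starts at
  an element \<open>\<ge> 2 ^ k\<close> and raises the size at most to the power \<open>d\<close>, so that
  \<open>X\<close> is exponentially large in \<open>K\<close> when \<open>m\<close> is fixed. As \<open>d / b\<close> and \<open>1 / \<rho>\<close> are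
  multiplicatively independent, an effective lower bound for linear forms in two
  logarithms (Gelfond) bounds \<open>X\<close> and hence the whole cycle explicitly; the algorithm is an
  exhaustive search below that bound.

  The lower bound is obtained from a polynomial \<open>P(X, Y)\<close> with small integer coefficients, found by
  the pigeonhole principle, such that \<open>P(x, exp (w x))\<close> is tiny on a long interval.
  If the linear form were too small, \<open>P\<close> would vanish by integrality at all points
  \<open>(r L + s K, \<alpha>\<^sup>r \<beta>\<^sup>s)\<close> of a large box, contradicting a zero estimate.
\<close>

text \<open>The two bounds for the linear form are far apart: for fixed d and m a cycle forces it
  below about exp(-cK), while the method gives a lower bound of the shape exp(-C log(K+L)^4). This
  slack permits crude constants; they only have to be explicit, as an ineffective bound would give
  no algorithm. It also permits a purely real form of Gelfond's method. Instead of letting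
  \<open>P(x, exp (w x))\<close> vanish at some points and extrapolating by a Schwarz lemma, all its
  low-order Taylor coefficients, in the variable scaled to the interval, are made small at once.
  This is possible because \<open>w\<close> times the length of the interval is only of order U n^2,
  so that about U n^3 Taylor terms face n^4 unknowns. Multiplicative independence enters through the
  distinctness of the points r L + s K, without which the zero estimate could not count
  roots.\<close>

section \<open>A zero estimate\<close>

text \<open>A kernel vector of the transpose holds the coefficients of a nonzero polynomial of
  degree below \<open>h\<close> with the \<open>h\<close> distinct roots \<open>x j\<close>.\<close>

lemma vandermonde_det_nonzero:
  fixes x :: "nat \<Rightarrow> 'a :: field"
  assumes inj: "inj_on x {..<h}"
  shows "det (mat h h (\<lambda>(i, j). x j ^ i)) \<noteq> 0"
proof
  define A where "A = mat h h (\<lambda>(j, i). x j ^ i)"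
  have A: "A \<in> carrier_mat h h" by (simp add: A_def)
  have "transpose_mat A = mat h h (\<lambda>(i, j). x j ^ i)"
    by (rule eq_matI) (auto simp: A_def)
  moreover assume "det (mat h h (\<lambda>(i, j). x j ^ i)) = 0"
  ultimately have "det A = 0" using det_transpose[OF A] by simp
  then obtain v where v: "v \<in> carrier_vec h" "v \<noteq> 0\<^sub>v h" "A *\<^sub>v v = 0\<^sub>v h"
    using det_0_iff_vec_prod_zero[OF A] by auto
  define p where "p = (\<Sum>i<h. monom (v $ i) i)"
  have coeff: "coeff p i = (if i < h then v $ i else 0)" for i
    by (simp add: p_def coeff_sum)
  have "p \<noteq> 0"
  proof
    assume "p = 0"
    then have "v $ i = 0" if "i < h" for i using coeff[of i] that by simp
    with v(1,2) show False by (auto simp: vec_eq_iff)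
  qed
  then have h: "0 < h" by (auto simp: p_def intro!: gr0I)
  have deg: "degree p < h"
    using h by (intro degree_lessI) (auto simp: coeff)
  have "poly p (x j) = 0" if "j < h" for j
  proof -
    have "0 = (A *\<^sub>v v) $ j" using v that by simp
    also have "\<dots> = (\<Sum>i<h. x j ^ i * v $ i)"
      using that v(1) by (simp add: A_def scalar_prod_def lessThan_atLeast0)
    finally show ?thesis by (simp add: p_def poly_sum poly_monom mult.commute)
  qed
  then have "x ` {..<h} \<subseteq> {z. poly p z = 0}" by auto
  then have "card (x ` {..<h}) \<le> card {z. poly p z = 0}"
    using \<open>p \<noteq> 0\<close> by (intro card_mono poly_roots_finite)
  also have "\<dots> \<le> degree p" using \<open>p \<noteq> 0\<close> by (rule card_poly_roots_bound)
  finally show False using deg inj by (simp add: card_image)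
qed

lemma lead_coeff_pcompose_linear:
  fixes p :: "'a :: idom poly"
  shows "degree (pcompose p [:u, 1:]) = degree p" "lead_coeff (pcompose p [:u, 1:]) = lead_coeff p"
  using lead_coeff_comp[of "[:u, 1:]" p] by (simp_all add: degree_pcompose)

text \<open>All terms of the Leibniz expansion have the same degree, because a translation changes
  neither degree nor leading coefficient. The top coefficients add up to a Vandermonde determinant
  times the product of the leading coefficients, so they cannot cancel.\<close>

lemma translates_det_nonzero:
  fixes p :: "nat \<Rightarrow> 'a :: field poly" and x u :: "nat \<Rightarrow> 'a"
  assumes inj: "inj_on x {..<h}" and nz: "\<And>j. j < h \<Longrightarrow> p j \<noteq> 0" "\<And>j. j < h \<Longrightarrow> x j \<noteq> 0"
  defines "M \<equiv> mat h h (\<lambda>(i, j). smult (x j ^ i) (pcompose (p j) [:u i, 1:]))"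
  shows "det M \<noteq> 0" and "degree (det M) \<le> (\<Sum>j<h. degree (p j))"
proof -
  let ?S = "{\<sigma>. \<sigma> permutes {0..<h}}" and ?D = "\<Sum>j<h. degree (p j)"
  have fin: "finite ?S" by (simp add: finite_permutations)
  define T where "T = (\<lambda>\<sigma>. \<Prod>i = 0..<h. M $$ (i, \<sigma> i))"
  have entry: "M $$ (i, \<sigma> i) \<noteq> 0"
     "degree (M $$ (i, \<sigma> i)) = degree (p (\<sigma> i))"
     "lead_coeff (M $$ (i, \<sigma> i)) = x (\<sigma> i) ^ i * lead_coeff (p (\<sigma> i))"
    if \<sigma>: "\<sigma> \<in> ?S" and i: "i < h" for \<sigma> i
  proof -
    have lt: "\<sigma> i < h" using \<sigma> i permutes_in_image[of \<sigma> "{0..<h}" i] by auto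
    have eq: "M $$ (i, \<sigma> i) = smult (x (\<sigma> i) ^ i) (pcompose (p (\<sigma> i)) [:u i, 1:])"
      using i lt by (simp add: M_def)
    show "degree (M $$ (i, \<sigma> i)) = degree (p (\<sigma> i))"
      unfolding eq using nz(2)[OF lt] by (simp add: lead_coeff_pcompose_linear)
    show lc: "lead_coeff (M $$ (i, \<sigma> i)) = x (\<sigma> i) ^ i * lead_coeff (p (\<sigma> i))"
      unfolding eq lead_coeff_smult lead_coeff_pcompose_linear(2) ..
    show "M $$ (i, \<sigma> i) \<noteq> 0"
    proof
      assume "M $$ (i, \<sigma> i) = 0"
      with lc show False using nz[OF lt] by simp
    qed
  qed
  have degT: "degree (T \<sigma>) = ?D" if "\<sigma> \<in> ?S" for \<sigma>
  proof -
    have "degree (T \<sigma>) = (\<Sum>i = 0..<h. degree (M $$ (i, \<sigma> i)))"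
      unfolding T_def using entry(1)[OF that] by (intro degree_prod_eq_sum_degree) auto
    also have "\<dots> = (\<Sum>i = 0..<h. degree (p (\<sigma> i)))"
      using entry(2)[OF that] by (intro sum.cong) auto
    also have "\<dots> = (\<Sum>i = 0..<h. degree (p i))"
      using that sum.permute[of \<sigma> "{0..<h}" "\<lambda>i. degree (p i)"] by (simp add: o_def)
    finally show ?thesis by (simp add: lessThan_atLeast0)
  qed
  have lcT: "coeff (T \<sigma>) ?D = (\<Prod>i = 0..<h. x (\<sigma> i) ^ i) * (\<Prod>i = 0..<h. lead_coeff (p i))"
    if "\<sigma> \<in> ?S" for \<sigma>
  proof -
    have "coeff (T \<sigma>) ?D = lead_coeff (T \<sigma>)" using degT[OF that] by simp
    also have "\<dots> = (\<Prod>i = 0..<h. lead_coeff (M $$ (i, \<sigma> i)))"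
      unfolding T_def by (rule lead_coeff_prod)
    also have "\<dots> = (\<Prod>i = 0..<h. x (\<sigma> i) ^ i * lead_coeff (p (\<sigma> i)))"
      using entry(3)[OF that] by (intro prod.cong) auto
    also have "\<dots> = (\<Prod>i = 0..<h. x (\<sigma> i) ^ i) * (\<Prod>i = 0..<h. lead_coeff (p (\<sigma> i)))"
      by (rule prod.distrib)
    also have "(\<Prod>i = 0..<h. lead_coeff (p (\<sigma> i))) = (\<Prod>i = 0..<h. lead_coeff (p i))"
      using that prod.permute[of \<sigma> "{0..<h}" "\<lambda>i. lead_coeff (p i)"] by (simp add: o_def)
    finally show ?thesis .
  qed
  have detM: "det M = (\<Sum>\<sigma>\<in>?S. signof \<sigma> * T \<sigma>)"
    unfolding T_def by (rule det_def') (simp add: M_def)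
  have sg: "signof \<sigma> * T \<sigma> = T \<sigma> \<or> signof \<sigma> * T \<sigma> = - T \<sigma>" for \<sigma>
    by (auto simp: sign_def)
  have sgc: "coeff (signof \<sigma> * T \<sigma>) ?D = signof \<sigma> * coeff (T \<sigma>) ?D" for \<sigma>
    by (auto simp: sign_def)
  show "degree (det M) \<le> ?D"
    unfolding detM
  proof (rule degree_sum_le[OF fin])
    fix \<sigma> assume "\<sigma> \<in> ?S"
    then show "degree (signof \<sigma> * T \<sigma>) \<le> ?D"
      using degT[of \<sigma>] sg[of \<sigma>] by auto
  qed
  have "coeff (det M) ?D = (\<Sum>\<sigma>\<in>?S. signof \<sigma> * (\<Prod>i = 0..<h. x (\<sigma> i) ^ i)) * (\<Prod>i = 0..<h. lead_coeff (p i))"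
    unfolding detM coeff_sum sum_distrib_right
    by (intro sum.cong refl) (simp add: sgc lcT mult.assoc)
  also have "(\<Sum>\<sigma>\<in>?S. signof \<sigma> * (\<Prod>i = 0..<h. x (\<sigma> i) ^ i)) = det (mat h h (\<lambda>(i, j). x j ^ i))"
  proof -
    have "det (mat h h (\<lambda>(i, j). x j ^ i)) = (\<Sum>\<sigma>\<in>?S. signof \<sigma> *
       (\<Prod>i = 0..<h. mat h h (\<lambda>(i, j). x j ^ i) $$ (i, \<sigma> i)))"
      by (rule det_def') simp
    also have "\<dots> = (\<Sum>\<sigma>\<in>?S. signof \<sigma> * (\<Prod>i = 0..<h. x (\<sigma> i) ^ i))"
    proof (intro sum.cong refl arg_cong2[of _ _ _ _ "(*)"] prod.cong)
      fix \<sigma> i assume "\<sigma> \<in> ?S" "i \<in> {0..<h}"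
      then have "\<sigma> i < h" "i < h" using permutes_in_image[of \<sigma> "{0..<h}" i] by auto
      then show "mat h h (\<lambda>(i, j). x j ^ i) $$ (i, \<sigma> i) = x (\<sigma> i) ^ i" by simp
    qed
    finally show ?thesis by simp
  qed
  finally have "coeff (det M) ?D \<noteq> 0"
    using vandermonde_det_nonzero[OF inj] nz by simp
  then show "det M \<noteq> 0" by auto
qed

text \<open>
  The translates \<open>P(X + iL, \<alpha>\<^sup>i Y)\<close> all vanish at the points with
  \<open>r, s < R\<close>, so the determinant of their coefficients, as linear forms in the powers of
  \<open>Y\<close>, is a polynomial in \<open>X\<close> with \<open>R\<^sup>2\<close> roots.
\<close>

lemma zero_estimate:
  fixes p :: "nat \<Rightarrow> real poly" and \<alpha> \<beta> :: real and K L :: nat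
  assumes \<alpha>: "\<alpha> > 1" and \<beta>: "\<beta> > 0"
    and deg: "\<And>l. l < n \<Longrightarrow> degree (p l) < D" and R: "n * D \<le> R * R" and R': "n + R \<le> R'"
    and inj: "inj_on (\<lambda>(r, s). r * L + s * K) ({..<R} \<times> {..<R})"
    and zero: "\<And>r s. r < R' \<Longrightarrow> s < R' \<Longrightarrow>
      (\<Sum>l<n. poly (p l) (real (r * L + s * K)) * (\<alpha> ^ r * \<beta> ^ s) ^ l) = 0"
    and l: "l < n"
  shows "p l = 0"
proof (rule ccontr)
  assume pl: "p l \<noteq> 0"
  define I where "I = {l. l < n \<and> p l \<noteq> 0}"
  define h where "h = card I"
  have finI: "finite I" and lI: "l \<in> I" using l pl by (auto simp: I_def)
  have h0: "0 < h" unfolding h_def using finI lI by (auto simp: card_gt_0_iff)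
  have hn: "h \<le> n" unfolding h_def using card_mono[of "{..<n}" I] by (auto simp: I_def)
  obtain g where g: "bij_betw g {0..<h} I"
    unfolding h_def using ex_bij_betw_nat_finite[OF finI] by blast
  have gI: "g j < n" "p (g j) \<noteq> 0" if "j < h" for j
    using bij_betwE[OF g] that by (auto simp: I_def)
  define x where "x = (\<lambda>j. \<alpha> ^ g j)"
  define M where "M = mat h h (\<lambda>(i, j). smult (x j ^ i) (pcompose (p (g j)) [:real (i * L), 1:]))"
  have injx: "inj_on x {..<h}"
  proof (rule inj_onI)
    fix i j assume ij: "i \<in> {..<h}" "j \<in> {..<h}" "x i = x j"
    then have "g i = g j" using \<alpha> by (simp add: x_def power_inject_exp)
    with ij g show "i = j" by (auto simp: bij_betw_def inj_on_def)
  qed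
  have x0: "x j \<noteq> 0" for j using \<alpha> by (simp add: x_def)
  have det: "det M \<noteq> 0" "degree (det M) \<le> (\<Sum>j<h. degree (p (g j)))"
    unfolding M_def using translates_det_nonzero[OF injx, of "\<lambda>j. p (g j)"] gI x0 by auto
  have "(\<Sum>j<h. degree (p (g j))) < (\<Sum>j<h. D)"
    using h0 gI deg by (intro sum_strict_mono) auto
  also have "\<dots> \<le> n * D" using hn by simp
  also note R
  finally have degM: "degree (det M) < R * R" using det(2) by linarith
  have root: "poly (det M) (real (r * L + s * K)) = 0" if r: "r < R" and s: "s < R" for r s
  proof -
    let ?X = "real (r * L + s * K)" and ?v = "\<alpha> ^ r * \<beta> ^ s"
    define A where "A = map_mat (\<lambda>q. poly q ?X) M"
    have A: "A \<in> carrier_mat h h" by (simp add: A_def M_def)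
    interpret ev: comm_ring_hom "\<lambda>q. poly q ?X" by unfold_locales auto
    have "det A = poly (det M) ?X" unfolding A_def by (rule ev.hom_det)
    moreover have "det A = 0"
      unfolding det_0_iff_vec_prod_zero[OF A]
    proof (intro exI conjI)
      \<comment> \<open>The powers of \<open>Y\<close> at the point lie in the kernel: row
        \<open>i\<close> gives the sum in \<open>zero\<close> at \<open>(r + i, s)\<close>, and
        \<open>i < h \<le> n\<close> keeps \<open>r + i\<close> below \<open>R'\<close>.\<close>
      let ?w = "vec h (\<lambda>j. ?v ^ g j)"
      show "?w \<in> carrier_vec h" by simp
      have "?v \<noteq> 0" using \<alpha> \<beta> by simp
      then have "?w $ 0 \<noteq> 0" using h0 by simp
      then show "?w \<noteq> 0\<^sub>v h" using h0 by (metis index_zero_vec(1))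
      show "A *\<^sub>v ?w = 0\<^sub>v h"
      proof (rule eq_vecI)
        fix i assume "i < dim_vec (0\<^sub>v h :: real vec)"
        then have i: "i < h" by simp
        have "(A *\<^sub>v ?w) $ i = (\<Sum>j<h. x j ^ i * poly (p (g j)) (real (i * L) + ?X) * ?v ^ g j)"
          using i by (simp add: A_def M_def scalar_prod_def lessThan_atLeast0 poly_pcompose)
        also have "\<dots> = (\<Sum>j<h. poly (p (g j)) (real ((r + i) * L + s * K)) * (\<alpha> ^ (r + i) * \<beta> ^ s) ^ g j)"
        proof (intro sum.cong refl)
          fix j
          have "x j ^ i * ?v ^ g j = (\<alpha> ^ (r + i) * \<beta> ^ s) ^ g j"
            unfolding x_def by (simp add: power_add power_mult_distrib flip: power_mult)
               (simp add: mult.commute)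
          moreover have "real (i * L) + ?X = real ((r + i) * L + s * K)"
            by (simp add: algebra_simps)
          ultimately show "x j ^ i * poly (p (g j)) (real (i * L) + ?X) * ?v ^ g j
              = poly (p (g j)) (real ((r + i) * L + s * K)) * (\<alpha> ^ (r + i) * \<beta> ^ s) ^ g j"
            by (metis mult.assoc mult.commute)
        qed
        also have "\<dots> = (\<Sum>l\<in>I. poly (p l) (real ((r + i) * L + s * K)) * (\<alpha> ^ (r + i) * \<beta> ^ s) ^ l)"
          using sum.reindex_bij_betw[OF g, of "\<lambda>l. poly (p l) (real ((r + i) * L + s * K)) * (\<alpha> ^ (r + i) * \<beta> ^ s) ^ l"]
          by (simp add: lessThan_atLeast0)
        also have "\<dots> = (\<Sum>l<n. poly (p l) (real ((r + i) * L + s * K)) * (\<alpha> ^ (r + i) * \<beta> ^ s) ^ l)"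
          by (intro sum.mono_neutral_left) (auto simp: I_def)
        also have "\<dots> = 0" using i hn r s R' by (intro zero) auto
        finally show "(A *\<^sub>v ?w) $ i = 0\<^sub>v h $ i" using i by simp
      qed (simp add: A_def M_def)
    qed
    ultimately show ?thesis by simp
  qed
  have "card ((\<lambda>(r, s). real (r * L + s * K)) ` ({..<R} \<times> {..<R})) \<le> card {z. poly (det M) z = 0}"
    using det(1) root by (intro card_mono poly_roots_finite) auto
  also have "\<dots> \<le> degree (det M)" using det(1) by (rule card_poly_roots_bound)
  also have "card ((\<lambda>(r, s). real (r * L + s * K)) ` ({..<R} \<times> {..<R})) = R * R"
  proof -
    have "inj_on (\<lambda>(r, s). real (r * L + s * K)) ({..<R} \<times> {..<R})"
      using inj unfolding inj_on_def by (auto simp only: split_beta of_nat_eq_iff)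
    then show ?thesis by (simp add: card_image card_cartesian_product)
  qed
  finally show False using degM by simp
qed

section \<open>Small exponential polynomials\<close>

text \<open>The \<open>H ^ card I\<close> vectors with entries in \<open>{0..<H}\<close> have form
  values in \<open>[0, H * M)\<close>, cut into \<open>H * V\<close> cells of width
  \<open>M / V\<close>. Two vectors in the same cells for all \<open>q < T\<close> differ by the
  wanted \<open>c\<close>: Siegel's lemma for real forms.\<close>

lemma small_linear_forms:
  fixes a :: "nat \<Rightarrow> 'i \<Rightarrow> real" and M :: real and H V T :: nat
  assumes fin: "finite I" and a: "\<And>q i. q < T \<Longrightarrow> i \<in> I \<Longrightarrow> 0 \<le> a q i"
    and sum: "\<And>q. q < T \<Longrightarrow> (\<Sum>i\<in>I. a q i) \<le> M" and M: "0 < M"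
    and pos: "0 < V" "0 < H" and card: "(H * V) ^ T < H ^ card I"
  obtains c :: "'i \<Rightarrow> int" where "\<exists>i\<in>I. c i \<noteq> 0" "\<And>i. i \<in> I \<Longrightarrow> \<bar>c i\<bar> \<le> int H"
    "\<And>q. q < T \<Longrightarrow> \<bar>\<Sum>i\<in>I. c i * a q i\<bar> \<le> M / V"
proof -
  define F where "F = (\<lambda>(c::'i \<Rightarrow> nat). \<lambda>q\<in>{..<T}. nat \<lfloor>(\<Sum>i\<in>I. c i * a q i) * V / M\<rfloor>)"
  define S where "S = I \<rightarrow>\<^sub>E {..<H}"
  have nonneg: "0 \<le> (\<Sum>i\<in>I. real (c i) * a q i) * V / M" if "q < T" for c q
    using a[OF that] M by (intro divide_nonneg_pos mult_nonneg_nonneg sum_nonneg) auto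
  have "F ` S \<subseteq> {..<T} \<rightarrow>\<^sub>E {..<H * V}"
  proof (intro image_subsetI PiE_I)
    fix c q assume c: "c \<in> S" and "q \<in> {..<T}"
    then have q: "q < T" by simp
    have "(\<Sum>i\<in>I. real (c i) * a q i) \<le> (\<Sum>i\<in>I. real (H - 1) * a q i)"
    proof (intro sum_mono mult_right_mono a q)
      fix i assume "i \<in> I"
      then have "c i < H" using c by (auto simp: S_def)
      then show "real (c i) \<le> real (H - 1)" by linarith
    qed
    also have "\<dots> \<le> real (H - 1) * M"
      unfolding sum_distrib_left[symmetric] using sum[OF q] by (intro mult_left_mono) auto
    also have "\<dots> < H * M" using pos M by simp
    finally have "(\<Sum>i\<in>I. real (c i) * a q i) * V / M < H * V"
      using M pos by (simp add: divide_less_eq mult.commute mult.left_commute)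
    then have "\<lfloor>(\<Sum>i\<in>I. real (c i) * a q i) * V / M\<rfloor> < int (H * V)"
      by (simp add: floor_less_iff)
    then show "F c q \<in> {..<H * V}"
      using q nonneg[OF q, of c] by (simp add: F_def nat_less_iff)
  qed (auto simp: F_def)
  then have "card (F ` S) \<le> card ({..<T} \<rightarrow>\<^sub>E {..<H * V})"
    by (intro card_mono finite_PiE) auto
  also have "\<dots> < card S"
    using card fin by (simp add: card_PiE S_def)
  finally have "\<not> inj_on F S" by (rule pigeonhole)
  then obtain c d where cd: "c \<in> S" "d \<in> S" "c \<noteq> d" "F c = F d"
    unfolding inj_on_def by blast
  show thesis
  proof (rule that[of "\<lambda>i. int (c i) - int (d i)"])
    show "\<exists>i\<in>I. int (c i) - int (d i) \<noteq> 0"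
    proof (rule ccontr)
      assume "\<not> ?thesis"
      then have "c i = d i" if "i \<in> I" for i using that by auto
      then have "c = d" using cd(1,2) unfolding S_def by (intro PiE_ext)
      with cd(3) show False ..
    qed
    show "\<bar>int (c i) - int (d i)\<bar> \<le> int H" if "i \<in> I" for i
    proof -
      have "c i < H" "d i < H" using cd(1,2) that by (auto simp: S_def)
      then show ?thesis by linarith
    qed
    show "\<bar>\<Sum>i\<in>I. real_of_int (int (c i) - int (d i)) * a q i\<bar> \<le> M / V" if q: "q < T" for q
    proof -
      let ?x = "(\<Sum>i\<in>I. real (c i) * a q i) * V / M" and ?y = "(\<Sum>i\<in>I. real (d i) * a q i) * V / M"
      have "nat \<lfloor>?x\<rfloor> = nat \<lfloor>?y\<rfloor>" using fun_cong[OF cd(4), of q] q by (simp add: F_def)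
      then have "\<lfloor>?x\<rfloor> = \<lfloor>?y\<rfloor>" using nonneg[OF q] by (simp add: nat_eq_iff)
      then have "\<bar>?x - ?y\<bar> \<le> 1" by linarith
      moreover have "?x - ?y = (\<Sum>i\<in>I. real_of_int (int (c i) - int (d i)) * a q i) * (V / M)"
        by (simp add: left_diff_distrib sum_subtractf diff_divide_distrib)
      ultimately have "\<bar>\<Sum>i\<in>I. real_of_int (int (c i) - int (d i)) * a q i\<bar> * (V / M) \<le> 1"
        using M by (simp add: abs_mult)
      then show ?thesis using M pos by (simp add: field_simps)
    qed
  qed
qed

section \<open>Estimates for the exponential series\<close>

lemma power_over_fact_le_exp:
  fixes z :: real assumes "0 \<le> z" shows "z ^ J / fact J \<le> exp z"
proof -
  obtain t where t: "exp z = (\<Sum>m<Suc J. z ^ m / fact m) + exp t / fact (Suc J) * z ^ Suc J"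
    using Maclaurin_exp_le[of z "Suc J"] by blast
  have "z ^ J / fact J \<le> (\<Sum>m<Suc J. z ^ m / fact m)"
    using assms by (intro member_le_sum) auto
  also have "\<dots> \<le> exp z" unfolding t using assms by simp
  finally show ?thesis .
qed

text \<open>Applying the preceding bound to \<open>exp 1 * z\<close> gains the factor
  \<open>exp (- J)\<close>, which makes Taylor remainders tiny once \<open>J\<close> is a large
  multiple of \<open>z\<close>.\<close>

lemma power_over_fact_le_exp_diff:
  fixes z :: real assumes "0 \<le> z" shows "z ^ J / fact J \<le> exp (3 * z - J)"
proof -
  have "z ^ J / fact J = (exp 1 * z) ^ J / fact J * exp (- real J)"
    by (simp add: power_mult_distrib exp_minus field_simps flip: exp_of_nat_mult)
  also have "\<dots> \<le> exp (exp 1 * z) * exp (- real J)"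
    using assms by (intro mult_right_mono power_over_fact_le_exp) auto
  also have "\<dots> \<le> exp (3 * z) * exp (- real J)"
    using assms exp_le by (intro mult_right_mono) (auto intro: mult_right_mono)
  finally show ?thesis by (simp add: exp_diff exp_minus field_simps)
qed

lemma exp_Taylor_bound:
  fixes z :: real assumes "0 \<le> z"
  shows "\<bar>exp z - (\<Sum>j<J. z ^ j / fact j)\<bar> \<le> exp z * (z ^ J / fact J)"
proof -
  obtain t where t: "\<bar>t\<bar> \<le> \<bar>z\<bar>" "exp z = (\<Sum>m<J. z ^ m / fact m) + exp t / fact J * z ^ J"
    using Maclaurin_exp_le[of z J] by blast
  have "exp z - (\<Sum>j<J. z ^ j / fact j) = exp t * (z ^ J / fact J)" using t(2) by simp
  moreover have "exp t * (z ^ J / fact J) \<le> exp z * (z ^ J / fact J)"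
    using t(1) assms by (intro mult_right_mono) auto
  ultimately show ?thesis using assms by simp
qed

lemma abs_exp_minus_one_le:
  fixes y :: real assumes "\<bar>y\<bar> \<le> 1" shows "\<bar>exp y - 1\<bar> \<le> 2 * \<bar>y\<bar>"
proof (cases "0 \<le> y")
  case True
  then have "exp y \<le> 1 + y + y\<^sup>2" using assms by (intro exp_bound) auto
  moreover have "y\<^sup>2 \<le> y" using True assms by (simp add: power2_eq_square mult_left_le)
  ultimately show ?thesis using True by simp
next
  case False
  then have "exp y \<le> 1" by simp
  with False show ?thesis using exp_ge_add_one_self[of y] by linarith
qed

lemma four_times_fourth_power_le_exp:
  assumes "4 \<le> n" shows "4 * real n ^ 4 \<le> exp (real n ^ 3)"
proof -
  have "4 * real n ^ 4 \<le> real n * real n ^ 4" using assms by (intro mult_right_mono) auto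
  also have "\<dots> = real n ^ 5" by (simp add: eval_nat_numeral)
  also have "\<dots> \<le> exp n ^ 5"
    using exp_ge_add_one_self[of "real n"] by (intro power_mono) linarith+
  also have "\<dots> = exp (5 * real n)" by (simp add: exp_of_nat_mult flip: exp_of_nat_mult)
  also have "\<dots> \<le> exp (real n ^ 3)"
  proof -
    have "5 * real n \<le> (real n * real n) * real n"
      using assms mult_mono[of 4 "real n" 4 "real n"] by (intro mult_right_mono) auto
    then show ?thesis by (simp add: power3_eq_cube)
  qed
  finally show ?thesis .
qed

text \<open>
  Expanding the exponentials to order \<open>J\<close> leaves \<open>N + J\<close> Taylor coefficients, at most half the
  number \<open>n * N\<close> of unknowns; this is what makes the pigeonhole principle applicable.
\<close>

lemma small_exponential_polynomial:
  fixes n U :: nat and w X :: real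
  defines "N \<equiv> n ^ 3"
  assumes U: "1 \<le> U" and n: "58 * U \<le> n" and X: "1 \<le> X" "ln X \<le> U"
    and w: "0 < w" "w * X \<le> 2 * real n ^ 2 * U"
  obtains c :: "nat \<times> nat \<Rightarrow> int" where "\<exists>i\<in>{..<N} \<times> {..<n}. c i \<noteq> 0"
    "\<And>i. i \<in> {..<N} \<times> {..<n} \<Longrightarrow> \<bar>c i\<bar> \<le> exp (11 * real (U * N))"
    "\<And>t. 0 \<le> t \<Longrightarrow> t \<le> X \<Longrightarrow>
      \<bar>\<Sum>(k, l)\<in>{..<N} \<times> {..<n}. c (k, l) * (t ^ k * exp (w * t) ^ l)\<bar> \<le> exp (- 4 * real (U * N)) / 2"
    "real n ^ 4 * X ^ N * exp (n * w * X) \<le> exp (4 * real (U * N))"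
proof -
  let ?I = "{..<N} \<times> {..<n}" and ?E = "real (U * N)"
  have n58: "58 \<le> n" using U n by linarith
  have N: "N \<ge> 1" "real N = real n ^ 3" using n58 by (simp_all add: N_def)
  have E1: "1 \<le> ?E" and EN: "real N \<le> ?E"
    using U N(1) by (simp_all flip: of_nat_mult)
  \<comment> \<open>The Taylor remainders sum to at most
    \<open>exp (11 * ?E + 4 * ?E + 6 * ?E - J) = exp (- 7 * ?E)\<close>. The factor 58 in the
    hypothesis on \<open>n\<close> is \<open>2 + 2 * 28\<close>, so that
    \<open>2 * T = N * (2 + 56 * U) \<le> N * n\<close>.\<close>
  define J where "J = 28 * (U * N)"
  define T where "T = N + J"
  define M where "M = real n ^ 4 * X ^ N * exp (n * w * X)"
  \<comment> \<open>Chosen so that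
    \<open>T * M / V \<le> exp (2 * ?E + 4 * ?E - 10 * ?E) / 4\<close>. With
    \<open>H = V + 1\<close> one has \<open>H * V < H * H\<close>, which together with
    \<open>2 * T \<le> n * N\<close> yields the counting condition of the pigeonhole
    principle.\<close>
  define V where "V = nat \<lceil>exp (10 * ?E)\<rceil>"
  define H where "H = V + 1"
  have nN: "real n * real N = real n ^ 4" by (simp add: N_def eval_nat_numeral)
  have z: "n * w * X \<le> 2 * ?E"
  proof -
    have "real n * (w * X) \<le> real n * (2 * real n ^ 2 * U)" using w(2) by (intro mult_left_mono) auto
    then show ?thesis by (simp add: N_def eval_nat_numeral mult_ac)
  qed
  have M0: "0 < M" using n58 X by (simp add: M_def)
  have n4: "4 * real n ^ 4 \<le> exp ?E"
    using four_times_fourth_power_le_exp[of n] n58 EN N(2) by (simp add: order_trans[OF _ iffD2[OF exp_le_cancel_iff]])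
  have ME: "M \<le> exp (4 * ?E)"
  proof -
    have "X ^ N = exp (N * ln X)" using X by (simp add: exp_of_nat_mult)
    also have "\<dots> \<le> exp ?E" using X(2) by (simp add: mult.commute mult_left_mono)
    finally have "X ^ N \<le> exp ?E" .
    moreover have "real n ^ 4 \<le> exp ?E" by (rule order_trans[OF _ n4]) simp
    ultimately have "M \<le> exp ?E * exp ?E * exp (2 * ?E)"
      unfolding M_def using z X by (intro mult_mono) auto
    also have "\<dots> = exp (4 * ?E)" by (simp flip: exp_add)
    finally show ?thesis .
  qed
  have V: "exp (10 * ?E) \<le> V" "V \<le> exp (10 * ?E) + 1" "0 < V"
    unfolding V_def by (auto simp: le_nat_iff zero_less_ceiling)
  have HE: "real H \<le> exp (11 * ?E)"
  proof -
    have e: "exp (11 * ?E) = exp (10 * ?E) * exp ?E" by (simp flip: exp_add)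
    have "2 \<le> exp ?E" using exp_ge_add_one_self[of ?E] E1 by linarith
    then have "2 * exp (10 * ?E) \<le> exp (11 * ?E)" unfolding e by simp
    moreover have "2 \<le> exp (10 * ?E)" using exp_ge_add_one_self[of "10 * ?E"] E1 by linarith
    ultimately show ?thesis using V(2) unfolding H_def by linarith
  qed
  have TU: "2 * T \<le> n * N"
  proof -
    have "2 * T = N * (2 + 56 * U)" by (simp add: T_def J_def algebra_simps)
    also have "\<dots> \<le> N * n" using U n by (intro mult_left_mono) auto
    finally show ?thesis by (simp add: mult.commute)
  qed
  have T4: "4 * real T \<le> exp (2 * ?E)"
  proof -
    have "real (2 * T) \<le> real (n * N)" using TU of_nat_le_iff by blast
    then have "4 * real T \<le> 2 * real n ^ 4" using nN by simp
    also have "\<dots> \<le> exp ?E" using n4 by (smt (verit) zero_le_power of_nat_0_le_iff)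
    also have "\<dots> \<le> exp (2 * ?E)" using E1 by simp
    finally show ?thesis .
  qed
  have T0: "0 < T" using N(1) unfolding T_def by linarith
  \<comment> \<open>\<open>a q (k, l)\<close> is the coefficient of \<open>(t / X) ^ q\<close> in
    \<open>t ^ k\<close> times the Taylor polynomial of \<open>exp (w * l * t)\<close>. After this
    scaling, smallness of the \<open>T\<close> coefficient forms gives smallness on all of
    \<open>[0, X]\<close>, not just at chosen points.\<close>
  define a where "a = (\<lambda>q (k, l). if k \<le> q \<and> q - k < J then X ^ k * ((w * real l * X) ^ (q - k) / fact (q - k)) else 0)"
  have a0: "0 \<le> a q i" for q i
    using w X by (auto simp: a_def split: prod.split)
  have aM: "(\<Sum>i\<in>?I. a q i) \<le> M" for q
  proof -
    have "a q i \<le> X ^ N * exp (n * w * X)" if "i \<in> ?I" for i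
    proof -
      obtain k l where i: "i = (k, l)" "k < N" "l < n" using \<open>i \<in> ?I\<close> by auto
      have "X ^ k * ((w * real l * X) ^ (q - k) / fact (q - k)) \<le> X ^ N * exp (n * w * X)"
      proof (intro mult_mono)
        show "X ^ k \<le> X ^ N" using i X by (intro power_increasing) auto
        have "(w * real l * X) ^ (q - k) / fact (q - k) \<le> exp (w * real l * X)"
          using w X by (intro power_over_fact_le_exp) auto
        also have "\<dots> \<le> exp (n * w * X)"
          using w X i by (simp add: mult.commute[of w] mult_right_mono)
        finally show "(w * real l * X) ^ (q - k) / fact (q - k) \<le> exp (n * w * X)" .
      qed (use w X in auto)
      moreover have "0 \<le> X ^ N * exp (n * w * X)" using X by simp
      ultimately show ?thesis by (simp add: a_def i)
    qed
    then have "(\<Sum>i\<in>?I. a q i) \<le> of_nat (card ?I) * (X ^ N * exp (n * w * X))"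
      by (rule sum_bounded_above)
    also have "\<dots> = M" by (simp add: card_cartesian_product M_def flip: nN)
    finally show ?thesis .
  qed
  have "(H * V) ^ T < H ^ card ?I"
  proof -
    have "(H * V) ^ T < (H * H) ^ T"
      using T0 V(3) by (intro power_strict_mono) (auto simp: H_def)
    also have "\<dots> = H ^ (2 * T)" by (simp add: power_mult power2_eq_square)
    also have "\<dots> \<le> H ^ card ?I"
      using TU by (intro power_increasing) (auto simp: H_def card_cartesian_product mult.commute)
    finally show ?thesis .
  qed
  then obtain c :: "nat \<times> nat \<Rightarrow> int" where c: "\<exists>i\<in>?I. c i \<noteq> 0"
      "\<And>i. i \<in> ?I \<Longrightarrow> \<bar>c i\<bar> \<le> int H" "\<And>q. q < T \<Longrightarrow> \<bar>\<Sum>i\<in>?I. c i * a q i\<bar> \<le> M / V"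
    using small_linear_forms[of ?I T a M V H] a0 aM M0 V(3) by (auto simp: H_def)
  have cH: "\<bar>real_of_int (c i)\<bar> \<le> real H" if "i \<in> ?I" for i
    using c(2)[OF that] by linarith
  show thesis
  proof (rule that[OF c(1)])
    show "\<bar>c i\<bar> \<le> exp (11 * ?E)" if "i \<in> ?I" for i
      using cH[OF that] HE by simp
    show "real n ^ 4 * X ^ N * exp (n * w * X) \<le> exp (4 * ?E)" using ME by (simp add: M_def)
    fix t :: real assume t: "0 \<le> t" "t \<le> X"
    define \<tau> where "\<tau> = t / X"
    have \<tau>: "0 \<le> \<tau>" "\<tau> \<le> 1" "t = \<tau> * X" using t X by (auto simp: \<tau>_def)
    define G where "G = (\<lambda>(k, l). t ^ k * (\<Sum>j<J. (w * real l * t) ^ j / fact j))"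
    have GA: "G i = (\<Sum>q<T. \<tau> ^ q * a q i)" if i: "i \<in> ?I" for i
    proof -
      obtain k l where kl: "i = (k, l)" "k < N" "l < n" using \<open>i \<in> ?I\<close> by auto
      have "(\<Sum>q<T. \<tau> ^ q * a q i) = (\<Sum>q\<in>(+) k ` {..<J}. \<tau> ^ q * a q i)"
      proof (intro sum.mono_neutral_right ballI)
        show "(+) k ` {..<J} \<subseteq> {..<T}" using kl by (auto simp: T_def)
        fix q assume q: "q \<in> {..<T} - (+) k ` {..<J}"
        have "\<not> (k \<le> q \<and> q - k < J)"
        proof
          assume "k \<le> q \<and> q - k < J"
          then have "q \<in> (+) k ` {..<J}" by (intro image_eqI[of _ _ "q - k"]) auto
          with q show False by blast
        qed
        then show "\<tau> ^ q * a q i = 0" by (auto simp: a_def kl)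
      qed simp
      also have "\<dots> = (\<Sum>j<J. \<tau> ^ (k + j) * a (k + j) i)"
        by (subst sum.reindex) auto
      also have "\<dots> = G i"
        unfolding G_def kl split_conv sum_distrib_left
        by (intro sum.cong) (simp_all add: a_def \<tau>(3) power_add power_mult_distrib mult_ac)
      finally show ?thesis by simp
    qed
    have main: "\<bar>\<Sum>i\<in>?I. c i * G i\<bar> \<le> exp (- 4 * ?E) / 4"
    proof -
      have "(\<Sum>i\<in>?I. c i * G i) = (\<Sum>i\<in>?I. \<Sum>q<T. \<tau> ^ q * (c i * a q i))"
        by (intro sum.cong refl) (simp add: GA sum_distrib_left mult_ac)
      also have "\<dots> = (\<Sum>q<T. \<tau> ^ q * (\<Sum>i\<in>?I. c i * a q i))"
        by (subst sum.swap) (simp add: sum_distrib_left)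
      finally have "\<bar>\<Sum>i\<in>?I. c i * G i\<bar> \<le> (\<Sum>q<T. \<bar>\<tau> ^ q * (\<Sum>i\<in>?I. c i * a q i)\<bar>)"
        by (simp only: sum_abs)
      also have "\<dots> \<le> (\<Sum>q<T. M / V)"
      proof (intro sum_mono)
        fix q assume "q \<in> {..<T}"
        then have "\<bar>\<tau> ^ q\<bar> * \<bar>\<Sum>i\<in>?I. c i * a q i\<bar> \<le> 1 * (M / V)"
          using \<tau> c(3)[of q] by (intro mult_mono) (auto intro: power_le_one)
        then show "\<bar>\<tau> ^ q * (\<Sum>i\<in>?I. c i * a q i)\<bar> \<le> M / V" by (simp add: abs_mult)
      qed
      also have "\<dots> = T * M / V" by simp
      also have "\<dots> \<le> (exp (2 * ?E) / 4 * exp (4 * ?E)) / exp (10 * ?E)"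
        using T4 ME M0 V by (intro frac_le mult_mono) auto
      also have "\<dots> = exp (- 4 * ?E) / 4"
        by (simp flip: exp_add exp_diff)
      finally show ?thesis .
    qed
    have rest: "\<bar>(\<Sum>i\<in>?I. c i * (case i of (k, l) \<Rightarrow> t ^ k * exp (w * t) ^ l)) - (\<Sum>i\<in>?I. c i * G i)\<bar>
       \<le> exp (- 4 * ?E) / 4"
    proof -
      have bound: "\<bar>c i * ((case i of (k, l) \<Rightarrow> t ^ k * exp (w * t) ^ l) - G i)\<bar>
         \<le> H * (X ^ N * (exp (n * w * X) * exp (3 * (2 * ?E) - J)))" if i: "i \<in> ?I" for i
      proof -
        obtain k l where kl: "i = (k, l)" "k < N" "l < n" using \<open>i \<in> ?I\<close> by auto
        let ?z = "w * real l * t"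
        have z0: "0 \<le> ?z" using w t by simp
        have zw: "?z \<le> n * w * X"
          unfolding mult.commute[of w] using w t kl by (intro mult_mono) auto
        have "\<bar>exp ?z - (\<Sum>j<J. ?z ^ j / fact j)\<bar> \<le> exp ?z * (?z ^ J / fact J)"
          using z0 by (rule exp_Taylor_bound)
        also have "\<dots> \<le> exp (n * w * X) * exp (3 * (2 * ?E) - J)"
        proof (intro mult_mono)
          have "?z ^ J / fact J \<le> exp (3 * ?z - J)" using z0 by (rule power_over_fact_le_exp_diff)
          also have "\<dots> \<le> exp (3 * (2 * ?E) - J)"
            unfolding exp_le_cancel_iff using zw z by linarith
          finally show "?z ^ J / fact J \<le> exp (3 * (2 * ?E) - J)" .
        qed (use z0 zw in auto)
        finally have "\<bar>t ^ k * (exp ?z - (\<Sum>j<J. ?z ^ j / fact j))\<bar> \<le> X ^ N * (exp (n * w * X) * exp (3 * (2 * ?E) - J))"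
        proof -
          assume *: "\<bar>exp ?z - (\<Sum>j<J. ?z ^ j / fact j)\<bar> \<le> exp (n * w * X) * exp (3 * (2 * ?E) - J)"
          have "t ^ k \<le> X ^ k" using t by (intro power_mono) auto
          also have "\<dots> \<le> X ^ N" using X kl by (intro power_increasing) auto
          finally have "\<bar>t ^ k\<bar> \<le> X ^ N" using t by simp
          then show ?thesis unfolding abs_mult using * by (intro mult_mono) auto
        qed
        moreover have "(case i of (k, l) \<Rightarrow> t ^ k * exp (w * t) ^ l) - G i = t ^ k * (exp ?z - (\<Sum>j<J. ?z ^ j / fact j))"
          by (simp add: kl G_def right_diff_distrib mult_ac flip: exp_of_nat_mult)
        ultimately show ?thesis
          unfolding abs_mult[of "real_of_int (c i)"] using cH[OF i] by (intro mult_mono) auto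
      qed
      have "\<bar>(\<Sum>i\<in>?I. c i * (case i of (k, l) \<Rightarrow> t ^ k * exp (w * t) ^ l)) - (\<Sum>i\<in>?I. c i * G i)\<bar>
         = \<bar>\<Sum>i\<in>?I. c i * ((case i of (k, l) \<Rightarrow> t ^ k * exp (w * t) ^ l) - G i)\<bar>"
        by (simp add: sum_subtractf right_diff_distrib)
      also have "\<dots> \<le> (\<Sum>i\<in>?I. \<bar>c i * ((case i of (k, l) \<Rightarrow> t ^ k * exp (w * t) ^ l) - G i)\<bar>)"
        by (rule sum_abs)
      also have "\<dots> \<le> of_nat (card ?I) * (H * (X ^ N * (exp (n * w * X) * exp (3 * (2 * ?E) - J))))"
        using bound by (rule sum_bounded_above)
      also have "\<dots> = H * M * exp (3 * (2 * ?E) - J)"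
        by (simp add: card_cartesian_product M_def flip: nN)
      also have "\<dots> \<le> exp (11 * ?E) * exp (4 * ?E) * exp (3 * (2 * ?E) - J)"
        using HE ME M0 by (intro mult_mono) auto
      also have "\<dots> = exp (- 4 * ?E) * exp (- 3 * ?E)"
        by (simp add: J_def flip: exp_add)
      also have "\<dots> \<le> exp (- 4 * ?E) * (1 / 4)"
      proof (intro mult_left_mono)
        have "4 \<le> exp (3 * ?E)" using exp_ge_add_one_self[of "3 * ?E"] E1 by linarith
        then show "exp (- 3 * ?E) \<le> 1 / 4" by (simp add: exp_minus field_simps)
      qed simp
      finally show ?thesis by simp
    qed
    have "\<bar>\<Sum>i\<in>?I. c i * (case i of (k, l) \<Rightarrow> t ^ k * exp (w * t) ^ l)\<bar> \<le> exp (- 4 * ?E) / 2"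
      using main rest by linarith
    then show "\<bar>\<Sum>(k, l)\<in>?I. c (k, l) * (t ^ k * exp (w * t) ^ l)\<bar> \<le> exp (- 4 * ?E) / 2"
      by (simp add: split_beta)
  qed
qed

section \<open>Linear forms in two logarithms\<close>

lemma ln_ratio_ge:
  fixes x y :: nat
  assumes "0 < x" "0 < y" "x \<noteq> y" "x \<le> Z" "y \<le> Z"
  shows "1 / Z \<le> \<bar>ln (real x / real y)\<bar>"
proof -
  have *: "1 / Z \<le> ln (real x / real y)" if "0 < y" "y < x" "x \<le> Z" for x y :: nat
  proof -
    have "1 / Z \<le> 1 / x" using that by (intro divide_left_mono) auto
    also have "\<dots> \<le> (x - y) / x" using that by (intro divide_right_mono) auto
    also have "\<dots> = 1 - y / x" using that by (simp add: diff_divide_distrib)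
    also have "\<dots> \<le> ln (real x / real y)"
      using ln_le_minus_one[of "real y / real x"] that by (simp add: ln_div)
    finally show ?thesis .
  qed
  show ?thesis
  proof (cases "y < x")
    case True
    then show ?thesis using *[of y x] assms by linarith
  next
    case False
    then have "1 / Z \<le> ln (real y / real x)" using *[of x y] assms by simp
    also have "\<dots> = - ln (real x / real y)" using assms by (simp add: ln_div)
    finally show ?thesis by linarith
  qed
qed

text \<open>A Liouville estimate: the distinct positive integers \<open>p1 ^ x * q2 ^ y\<close> and
  \<open>q1 ^ x * p2 ^ y\<close>, both at most \<open>Q ^ (2 * Z)\<close>, have a ratio bounded away
  from 1. The bound is exponential in \<open>Z\<close>, too weak for the exponents of a cycle but
  sufficient for those of the box of points.\<close>

lemma log_combination_lower_bound:
  fixes p1 q1 p2 q2 Q :: nat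
  assumes pos: "0 < p1" "0 < q1" "0 < p2" "0 < q2" and Q: "p1 \<le> Q" "q1 \<le> Q" "p2 \<le> Q" "q2 \<le> Q"
    and xy: "x \<le> Z" "y \<le> Z" and ne: "(real p1 / real q1) ^ x \<noteq> (real p2 / real q2) ^ y"
  shows "1 / real (Q ^ Z * Q ^ Z) \<le> \<bar>x * ln (real p1 / real q1) - y * ln (real p2 / real q2)\<bar>"
proof -
  let ?a = "p1 ^ x * q2 ^ y" and ?b = "q1 ^ x * p2 ^ y"
  have le: "p ^ e \<le> Q ^ Z" if "p \<le> Q" "e \<le> Z" for p e
  proof -
    have "p ^ e \<le> Q ^ e" using that by (intro power_mono) auto
    also have "\<dots> \<le> Q ^ Z" using that Q pos by (intro power_increasing) auto
    finally show ?thesis .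
  qed
  have "?a \<noteq> ?b"
  proof
    assume "?a = ?b"
    then have "real p1 ^ x * real q2 ^ y = real q1 ^ x * real p2 ^ y"
      unfolding of_nat_power[symmetric] of_nat_mult[symmetric] by (rule arg_cong)
    with ne pos show False by (simp add: power_divide field_simps)
  qed
  then have "1 / real (Q ^ Z * Q ^ Z) \<le> \<bar>ln (real ?a / real ?b)\<bar>"
    using pos by (intro ln_ratio_ge mult_mono le Q xy) auto
  also have "real ?a / real ?b = (real p1 / real q1) ^ x / (real p2 / real q2) ^ y"
    using pos by (simp add: power_divide)
  also have "ln \<dots> = x * ln (real p1 / real q1) - y * ln (real p2 / real q2)"
    using pos by (subst ln_div) (auto simp: ln_realpow)
  finally show ?thesis .
qed

text \<open>
  \<open>P\<close> has degree below \<open>n ^ 3\<close> in \<open>X\<close> and below \<open>n\<close> in \<open>Y\<close>, and \<open>r, s < 2 * n ^ 2\<close>. All sizes,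
  denominators included, are then at most \<open>exp (c * U * n ^ 3)\<close> with a constant \<open>c\<close>, which is
  beaten by the gain \<open>exp (- n ^ 4)\<close>.
\<close>

lemma two_logarithms_lower_bound:
  fixes p1 q1 p2 q2 Q U n K L :: nat
  defines "\<alpha> \<equiv> real p1 / real q1" and "\<beta> \<equiv> real p2 / real q2"
  assumes pq: "0 < q1" "q1 < p1" "p1 \<le> Q" "0 < q2" "q2 < p2" "p2 \<le> Q"
    and indep: "\<And>x y. 0 < x \<Longrightarrow> 0 < y \<Longrightarrow> \<alpha> ^ x \<noteq> \<beta> ^ y"
    and KL: "0 < K" "0 < L"
    and U: "ln \<alpha> + ln \<beta> + 1 \<le> U" "ln Q \<le> U" "ln (2 * real n ^ 2 * (K + L)) \<le> U"
    and n: "58 * U \<le> n"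
  shows "exp (- (real n ^ 4)) < \<bar>K * ln \<alpha> - L * ln \<beta>\<bar>"
proof (rule ccontr)
  define \<Lambda> where "\<Lambda> = K * ln \<alpha> - L * ln \<beta>"
  define N where "N = n ^ 3"
  \<comment> \<open>\<open>[0, X]\<close> contains all points \<open>r * L + s * K\<close> with
    \<open>r, s < 2 * n ^ 2\<close>. By the choice of \<open>w\<close> below,
    \<open>exp (w * L) = \<alpha>\<close> and
    \<open>exp (w * K) = \<beta> * exp (\<Lambda> / L)\<close>, so at such a point
    \<open>exp (w * t)\<close> is \<open>\<alpha> ^ r * \<beta> ^ s\<close> up to a factor close to
    1.\<close>
  define X where "X = 2 * real n ^ 2 * (K + L)"
  define w where "w = ln \<alpha> / L"
  let ?E = "real (U * N)" and ?I = "{..<N} \<times> {..<n}"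
  assume "\<not> ?thesis"
  then have \<Lambda>: "\<bar>\<Lambda>\<bar> \<le> exp (- (real n ^ 4))" by (simp add: \<Lambda>_def)
  have \<alpha>: "1 < \<alpha>" and \<beta>: "1 < \<beta>" using pq by (simp_all add: \<alpha>_def \<beta>_def)
  then have ln0: "0 < ln \<alpha>" "0 < ln \<beta>" by simp_all
  then have U1: "1 \<le> U" using U(1) by linarith
  with n have n58: "58 \<le> n" by linarith
  have N1: "1 \<le> N" using n58 by (simp add: N_def)
  have E58: "58 * ?E \<le> real n ^ 4"
  proof -
    have "real (58 * U) * real n ^ 3 \<le> real n * real n ^ 3" using n by (intro mult_right_mono of_nat_mono) auto
    then show ?thesis by (simp add: N_def eval_nat_numeral)
  qed
  have E1: "1 \<le> ?E" using U1 N1 by (simp flip: of_nat_mult)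
  have EN: "real N \<le> ?E"
  proof (rule of_nat_mono)
    show "N \<le> U * N" using U1 by simp
  qed
  have X1: "1 \<le> X"
  proof -
    have "1 * 1 \<le> (2 * real n ^ 2) * (K + L)"
    proof (intro mult_mono)
      have "1 \<le> real n ^ 2" using n58 by simp
      then show "1 \<le> 2 * real n ^ 2" by linarith
    qed (use KL in auto)
    then show ?thesis by (simp add: X_def)
  qed
  have \<Lambda>1: "\<bar>\<Lambda>\<bar> \<le> 1" by (rule order_trans[OF \<Lambda>]) simp
  have w: "0 < w" "w * X \<le> 2 * real n ^ 2 * U"
  proof -
    show "0 < w" using ln0 KL by (simp add: w_def)
    have "K * ln \<alpha> \<le> L * ln \<beta> + 1" using \<Lambda>1 by (simp add: \<Lambda>_def)
    also have "\<dots> \<le> L * ln \<beta> + L" using KL by simp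
    finally have "K * ln \<alpha> / L \<le> ln \<beta> + 1" using KL by (simp add: field_simps)
    then have "w * (K + L) \<le> U"
      using U(1) KL by (simp add: w_def distrib_left add_divide_distrib mult.commute)
    then have "2 * real n ^ 2 * (w * (K + L)) \<le> 2 * real n ^ 2 * U" by (intro mult_left_mono) auto
    then show "w * X \<le> 2 * real n ^ 2 * U" by (simp add: X_def mult_ac)
  qed
  have lnX: "ln X \<le> U" using U(3) by (simp add: X_def)
  obtain c :: "nat \<times> nat \<Rightarrow> int" where c: "\<exists>i\<in>?I. c i \<noteq> 0"
      "\<And>i. i \<in> ?I \<Longrightarrow> \<bar>c i\<bar> \<le> exp (11 * ?E)"
      "\<And>t. 0 \<le> t \<Longrightarrow> t \<le> X \<Longrightarrow>
        \<bar>\<Sum>(k, l)\<in>?I. c (k, l) * (t ^ k * exp (w * t) ^ l)\<bar> \<le> exp (- 4 * ?E) / 2"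
      "real n ^ 4 * X ^ N * exp (n * w * X) \<le> exp (4 * ?E)"
    apply (rule small_exponential_polynomial[OF U1 n X1 lnX w, folded N_def])
    subgoal premises prems for c using prems(2-) by (rule prems(1))
    done
  define p where "p = (\<lambda>l. \<Sum>k<N. monom (real_of_int (c (k, l))) k)"
  have poly_p: "poly (p l) x = (\<Sum>k<N. c (k, l) * x ^ k)" for l and x :: real
    by (simp add: p_def poly_sum poly_monom)
  have coeff_p: "coeff (p l) k = (if k < N then real_of_int (c (k, l)) else 0)" for l k
    by (simp add: p_def coeff_sum)
  \<comment> \<open>For \<open>r, s < 2 * n ^ 2\<close> and \<open>l < n\<close> the exponents
    \<open>r * l\<close> and \<open>s * l\<close> are at most \<open>2 * N\<close>, so
    \<open>den\<close> clears all denominators.\<close>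
  define den where "den = (real q1 * real q2) ^ (2 * N)"
  have den0: "0 < den" using pq by (simp add: den_def)
  have den: "den \<le> exp (4 * ?E)"
  proof -
    have "real q1 * real q2 \<le> real Q * real Q" using pq by (intro mult_mono) auto
    then have "den \<le> (real Q * real Q) ^ (2 * N)"
      unfolding den_def by (intro power_mono) auto
    also have "\<dots> = real Q ^ (4 * N)" by (simp flip: power2_eq_square power_mult)
    also have "\<dots> = exp (real (4 * N) * ln Q)"
      unfolding exp_of_nat_mult using pq by simp
    also have "\<dots> \<le> exp (4 * ?E)" using U(2) by (simp add: mult.commute mult_left_mono)
    finally show ?thesis .
  qed
  have zero: "(\<Sum>l<n. poly (p l) (real (r * L + s * K)) * (\<alpha> ^ r * \<beta> ^ s) ^ l) = 0"
    if r: "r < 2 * n ^ 2" and s: "s < 2 * n ^ 2" for r s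
  proof -
    define t where "t = real (r * L + s * K)"
    define Y where "Y = \<alpha> ^ r * \<beta> ^ s"
    have t: "0 \<le> t" "t \<le> X"
    proof -
      have "r * L + s * K \<le> 2 * n ^ 2 * L + 2 * n ^ 2 * K"
        using r s by (intro add_mono mult_right_mono) auto
      then have "t \<le> real (2 * n ^ 2 * L + 2 * n ^ 2 * K)" unfolding t_def by (rule of_nat_mono)
      then show "t \<le> X" by (simp add: X_def algebra_simps)
    qed (simp add: t_def)
    have wt: "exp (w * t) = Y * exp (s * \<Lambda> / L)"
    proof -
      have "w * t = r * ln \<alpha> + s * (K * ln \<alpha> / L)"
        using KL by (simp add: w_def t_def field_simps)
      also have "K * ln \<alpha> / L = ln \<beta> + \<Lambda> / L"
        using KL by (simp add: \<Lambda>_def field_simps)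
      finally have "w * t = r * ln \<alpha> + s * ln \<beta> + s * \<Lambda> / L" by (simp add: algebra_simps)
      then show ?thesis using \<alpha> \<beta> by (simp add: Y_def exp_add exp_of_nat_mult)
    qed
    let ?P = "\<Sum>(k, l)\<in>?I. c (k, l) * (t ^ k * Y ^ l)"
    let ?F = "\<Sum>(k, l)\<in>?I. c (k, l) * (t ^ k * exp (w * t) ^ l)"
    have swap: "(\<Sum>l<n. poly (p l) t * Y ^ l) = ?P"
    proof -
      have "(\<Sum>l<n. poly (p l) t * Y ^ l) = (\<Sum>l<n. \<Sum>k<N. c (k, l) * (t ^ k * Y ^ l))"
        by (simp add: poly_p sum_distrib_right mult.assoc)
      also have "\<dots> = (\<Sum>k<N. \<Sum>l<n. c (k, l) * (t ^ k * Y ^ l))" by (rule sum.swap)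
      finally show ?thesis by (simp add: sum.cartesian_product)
    qed
    \<comment> \<open>Replacing \<open>exp (w * t)\<close> by the rational number \<open>Y\<close>
      costs at most \<open>exp (11 * ?E + 4 * ?E + 4 * ?E - 58 * ?E)\<close>, as
      \<open>\<bar>\<Lambda>\<bar>\<close> is at most \<open>exp (- 58 * ?E)\<close>.\<close>
    have diff: "\<bar>?P - ?F\<bar> \<le> exp (- 4 * ?E) / 4"
    proof -
      have bound: "\<bar>c (k, l) * (t ^ k * (Y ^ l - exp (w * t) ^ l))\<bar>
          \<le> exp (11 * ?E) * (X ^ N * (exp (n * w * X) * (4 * N * \<bar>\<Lambda>\<bar>)))"
        if kl: "k < N" "l < n" for k l
      proof -
        let ?y = "- (l * (s * \<Lambda> / L))"
        have "Y = exp (w * t) * exp (- (s * \<Lambda> / L))" using wt by (simp add: exp_minus)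
        then have "Y ^ l = exp (w * t) ^ l * exp ?y"
          by (simp add: power_mult_distrib flip: exp_of_nat_mult)
        then have "Y ^ l - exp (w * t) ^ l = exp (l * (w * t)) * (exp ?y - 1)"
          by (simp add: right_diff_distrib flip: exp_of_nat_mult)
        moreover have "\<bar>exp ?y - 1\<bar> \<le> 4 * N * \<bar>\<Lambda>\<bar>"
        proof -
          have "real (l * s) / L \<le> real (l * s) / 1" using KL by (intro divide_left_mono) auto
          also have "\<dots> \<le> real (n * (2 * n ^ 2))"
            unfolding div_by_1 using kl s by (intro of_nat_mono mult_mono) auto
          also have "\<dots> = 2 * N" by (simp add: N_def eval_nat_numeral)
          finally have "real (l * s) / L * \<bar>\<Lambda>\<bar> \<le> 2 * N * \<bar>\<Lambda>\<bar>" by (intro mult_right_mono) auto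
          then have y: "\<bar>?y\<bar> \<le> 2 * N * \<bar>\<Lambda>\<bar>" using KL by (simp add: abs_mult mult_ac)
          have "2 * N * \<bar>\<Lambda>\<bar> \<le> 1"
          proof -
            have "2 * real N \<le> exp (58 * ?E)"
            proof -
              show ?thesis using EN exp_ge_add_one_self[of "58 * ?E"] E1 by linarith
            qed
            also have "\<dots> \<le> exp (real n ^ 4)" using E58 by simp
            finally have "2 * N * \<bar>\<Lambda>\<bar> \<le> exp (real n ^ 4) * exp (- (real n ^ 4))"
              using \<Lambda> by (intro mult_mono) auto
            then show ?thesis by (simp flip: exp_add)
          qed
          with y have "\<bar>exp ?y - 1\<bar> \<le> 2 * \<bar>?y\<bar>" by (intro abs_exp_minus_one_le) linarith
          with y show ?thesis by linarith
        qed
        moreover have "exp (l * (w * t)) \<le> exp (n * w * X)"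
        proof -
          have "real l * (w * t) \<le> real n * (w * X)" using kl w t by (intro mult_mono) auto
          then show ?thesis by (simp add: mult.assoc)
        qed
        moreover have "t ^ k \<le> X ^ N"
          using t X1 kl by (intro order_trans[OF power_mono[of t X k] power_increasing]) auto
        moreover have "\<bar>real_of_int (c (k, l))\<bar> \<le> exp (11 * ?E)" using c(2)[of "(k, l)"] kl by simp
        ultimately show ?thesis
          unfolding abs_mult using t X1 by (intro mult_mono) (auto simp: abs_mult intro!: mult_mono)
      qed
      have "?P - ?F = (\<Sum>(k, l)\<in>?I. c (k, l) * (t ^ k * (Y ^ l - exp (w * t) ^ l)))"
        by (simp add: split_beta sum_subtractf right_diff_distrib)
      also have "\<bar>\<dots>\<bar> \<le> (\<Sum>(k, l)\<in>?I. \<bar>c (k, l) * (t ^ k * (Y ^ l - exp (w * t) ^ l))\<bar>)"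
        by (simp add: split_beta sum_abs)
      also have "\<dots> \<le> of_nat (card ?I) * (exp (11 * ?E) * (X ^ N * (exp (n * w * X) * (4 * N * \<bar>\<Lambda>\<bar>))))"
        using bound by (intro sum_bounded_above) auto
      also have "\<dots> = exp (11 * ?E) * (real n ^ 4 * X ^ N * exp (n * w * X)) * (4 * N * \<bar>\<Lambda>\<bar>)"
        by (simp add: card_cartesian_product N_def eval_nat_numeral mult_ac)
      also have "\<dots> \<le> exp (11 * ?E) * exp (4 * ?E) * (exp (4 * ?E) * exp (- (58 * ?E)))"
      proof (intro mult_mono)
        have "real (4 * N) = 4 * real N" by simp
        then show "real (4 * N) \<le> exp (4 * ?E)"
          using EN exp_ge_add_one_self[of "4 * ?E"] by linarith
        show "\<bar>\<Lambda>\<bar> \<le> exp (- (58 * ?E))" by (rule order_trans[OF \<Lambda>]) (use E58 in simp)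
      qed (use c(4) X1 in auto)
      also have "\<dots> = exp (- 4 * ?E) * exp (- 35 * ?E)" by (simp flip: exp_add)
      also have "\<dots> \<le> exp (- 4 * ?E) * (1 / 4)"
      proof (intro mult_left_mono)
        have "4 \<le> exp (35 * ?E)" using exp_ge_add_one_self[of "35 * ?E"] E1 by linarith
        then show "exp (- 35 * ?E) \<le> 1 / 4" by (simp add: exp_minus field_simps)
      qed simp
      finally show ?thesis by simp
    qed
    \<comment> \<open>The two errors leave \<open>\<bar>?P\<bar>\<close> at most 3/4 of
      \<open>exp (- 4 * ?E)\<close>, whence the integer \<open>den * ?P\<close> is below 1 in
      absolute value and vanishes.\<close>
    have "\<bar>?P\<bar> < exp (- 4 * ?E)"
      using diff c(3)[OF t] exp_gt_zero[of "- 4 * ?E"] by linarith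
    then have "den * \<bar>?P\<bar> < exp (4 * ?E) * exp (- 4 * ?E)"
      using den den0 by (intro mult_le_less_imp_less) auto
    then have "\<bar>den * ?P\<bar> < 1" using den0 by (simp add: abs_mult flip: exp_add)
    moreover have "den * ?P \<in> \<int>"
    proof -
      have "den * Y ^ l \<in> \<int>" if l: "l < n" for l
      proof -
        have le: "x * l \<le> 2 * N" if "x < 2 * n ^ 2" for x
        proof -
          have "x * l \<le> 2 * n ^ 2 * n" using that l by (intro mult_mono) auto
          then show ?thesis by (simp add: N_def eval_nat_numeral algebra_simps)
        qed
        have frac: "q ^ (2 * N) * ((p / q) ^ x) ^ l = p ^ (x * l) * q ^ (2 * N - x * l)"
          if "0 < q" "x < 2 * n ^ 2" for p q :: real and x
          using le[OF that(2)] that(1)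
          by (simp add: power_divide power_diff flip: power_mult)
        have "den * Y ^ l = (q1 ^ (2 * N) * ((real p1 / q1) ^ r) ^ l) * (q2 ^ (2 * N) * ((real p2 / q2) ^ s) ^ l)"
          by (simp add: den_def Y_def \<alpha>_def \<beta>_def power_mult_distrib mult_ac)
        also have "\<dots> = of_nat (p1 ^ (r * l) * q1 ^ (2 * N - r * l) * (p2 ^ (s * l) * q2 ^ (2 * N - s * l)))"
          using frac[of q1 r p1] frac[of q2 s p2] pq r s by simp
        also have "\<dots> \<in> \<int>" by (rule Ints_of_nat)
        finally show ?thesis .
      qed
      note int_Y = this
      have "t \<in> \<int>" unfolding t_def by (rule Ints_of_nat)
      then have "c (k, l) * (t ^ k * (den * Y ^ l)) \<in> \<int>" if "l < n" for k l
        by (rule Ints_mult[OF Ints_of_int Ints_mult[OF Ints_power int_Y[OF that]]])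
      then have "(\<Sum>(k, l)\<in>?I. c (k, l) * (t ^ k * (den * Y ^ l))) \<in> \<int>"
        by (intro Ints_sum) auto
      also have "(\<Sum>(k, l)\<in>?I. c (k, l) * (t ^ k * (den * Y ^ l))) = den * ?P"
        unfolding sum_distrib_left by (intro sum.cong) (auto simp: mult_ac)
      finally show ?thesis .
    qed
    ultimately have "den * ?P = 0" using Ints_nonzero_abs_less1 by blast
    then have "?P = 0" using den0 by simp
    with swap show ?thesis by (simp only: t_def Y_def)
  qed
  \<comment> \<open>A coincidence of two points gives \<open>\<rho> * L = \<sigma> * K\<close> with
    positive \<open>\<rho>\<close> and \<open>\<sigma>\<close> at most \<open>n ^ 2\<close>, so that
    \<open>K * (\<rho> * ln \<alpha> - \<sigma> * ln \<beta>) = \<rho> * \<Lambda>\<close>. This is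
    far below the Liouville bound for such small exponents.\<close>
  have inj: "inj_on (\<lambda>(r, s). r * L + s * K) ({..<n ^ 2} \<times> {..<n ^ 2})"
  proof -
    have False if eq: "r * L + s * K = r' * L + s' * K" and less: "r < r'" "r' < n ^ 2" "s < n ^ 2" for r s r' s'
    proof -
      define \<rho> where "\<rho> = r' - r"
      have "s' < s"
      proof (rule ccontr)
        assume "\<not> s' < s"
        then have "s * K \<le> s' * K" by simp
        moreover have "r * L < r' * L" using less KL by simp
        ultimately show False using eq by linarith
      qed
      define \<sigma> where "\<sigma> = s - s'"
      have \<rho>: "0 < \<rho>" "\<rho> \<le> n ^ 2" and \<sigma>: "0 < \<sigma>" "\<sigma> \<le> n ^ 2"
        using less \<open>s' < s\<close> by (auto simp: \<rho>_def \<sigma>_def)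
      have "r' = r + \<rho>" "s = s' + \<sigma>" using less \<open>s' < s\<close> by (auto simp: \<rho>_def \<sigma>_def)
      with eq have eq': "\<rho> * L = \<sigma> * K" by (simp add: algebra_simps)
      have "1 / real (Q ^ n ^ 2 * Q ^ n ^ 2) \<le> \<bar>\<rho> * ln \<alpha> - \<sigma> * ln \<beta>\<bar>"
        unfolding \<alpha>_def \<beta>_def
        by (rule log_combination_lower_bound) (use pq \<rho> \<sigma> indep in \<open>auto simp: \<alpha>_def \<beta>_def\<close>)
      also have "\<dots> \<le> n ^ 2 * \<bar>\<Lambda>\<bar>"
      proof -
        have "real \<sigma> * K = real \<rho> * L" using eq' by (metis of_nat_mult)
        then have "K * (\<rho> * ln \<alpha> - \<sigma> * ln \<beta>) = \<rho> * (K * ln \<alpha>) - (real \<rho> * L) * ln \<beta>"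
          by (simp add: right_diff_distrib mult_ac)
        also have "\<dots> = \<rho> * \<Lambda>" by (simp add: \<Lambda>_def right_diff_distrib mult_ac)
        finally have "\<bar>K * (\<rho> * ln \<alpha> - \<sigma> * ln \<beta>)\<bar> = \<bar>\<rho> * \<Lambda>\<bar>" by (rule arg_cong)
        then have "K * \<bar>\<rho> * ln \<alpha> - \<sigma> * ln \<beta>\<bar> = \<rho> * \<bar>\<Lambda>\<bar>" by (simp add: abs_mult)
        moreover have "1 * \<bar>\<rho> * ln \<alpha> - \<sigma> * ln \<beta>\<bar> \<le> K * \<bar>\<rho> * ln \<alpha> - \<sigma> * ln \<beta>\<bar>"
          using KL by (intro mult_right_mono) auto
        moreover have "real \<rho> * \<bar>\<Lambda>\<bar> \<le> n ^ 2 * \<bar>\<Lambda>\<bar>" using \<rho> by (intro mult_right_mono of_nat_mono) auto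
        ultimately show ?thesis by (simp only: mult_1 order_trans)
      qed
      also have "\<dots> \<le> exp ?E * exp (- (58 * ?E))"
      proof (intro mult_mono)
        have "n ^ 2 \<le> N" using n58 unfolding N_def by (intro power_increasing) auto
        also have "\<dots> \<le> U * N" using U1 by simp
        finally have "real (n ^ 2) \<le> ?E" by (rule of_nat_mono)
        then show "real (n ^ 2) \<le> exp ?E" using exp_ge_add_one_self[of ?E] by linarith
        show "\<bar>\<Lambda>\<bar> \<le> exp (- (58 * ?E))" by (rule order_trans[OF \<Lambda>]) (use E58 in simp)
      qed auto
      also have "\<dots> < exp (- (2 * ?E))"
        unfolding exp_add[symmetric] exp_less_cancel_iff using E1 by linarith
      also have "\<dots> \<le> 1 / real (Q ^ n ^ 2 * Q ^ n ^ 2)"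
      proof -
        have "real (Q ^ n ^ 2) = exp (real (n ^ 2) * ln Q)"
          unfolding exp_of_nat_mult using pq by simp
        also have "\<dots> \<le> exp ?E"
        proof -
          have "n ^ 2 \<le> N" using n58 unfolding N_def by (intro power_increasing) auto
          then have "real (n ^ 2) * ln Q \<le> real N * U" using U(2) pq by (intro mult_mono of_nat_mono) auto
          then show ?thesis by (simp add: mult.commute)
        qed
        finally have "real (Q ^ n ^ 2) * real (Q ^ n ^ 2) \<le> exp ?E * exp ?E" by (intro mult_mono) auto
        then have "real (Q ^ n ^ 2 * Q ^ n ^ 2) \<le> exp (2 * ?E)" by (simp add: mult.commute flip: exp_add)
        moreover have "0 < real (Q ^ n ^ 2 * Q ^ n ^ 2)" using pq by simp
        ultimately have "1 / exp (2 * ?E) \<le> 1 / real (Q ^ n ^ 2 * Q ^ n ^ 2)" by (intro divide_left_mono) auto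
        then show ?thesis by (simp add: exp_minus field_simps)
      qed
      finally show False by simp
    qed note no = this
    show ?thesis
    proof (rule inj_onI, clarsimp)
      fix r s r' s' assume *: "r < n\<^sup>2" "s < n\<^sup>2" "r' < n\<^sup>2" "s' < n\<^sup>2" "r * L + s * K = r' * L + s' * K"
      then have "r = r'" using no[of r s r' s'] no[of r' s' r s] by (metis linorder_neqE_nat)
      with * KL show "r = r' \<and> s = s'" by simp
    qed
  qed
  \<comment> \<open>The count is tight: \<open>n * N = n ^ 4 = R * R\<close>. The doubled range
    \<open>R'\<close> leaves room for the translates.\<close>
  have p0: "p l = 0" if l: "l < n" for l
  proof (rule zero_estimate[where R = "n ^ 2" and R' = "2 * n ^ 2" and D = N, OF \<alpha> _ _ _ _ inj zero l])
    show "degree (p l') < N" for l'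
      using N1 by (intro degree_lessI) (auto simp: coeff_p)
    show "n * N \<le> n\<^sup>2 * n\<^sup>2" by (simp add: N_def eval_nat_numeral)
    have "n * 1 \<le> n * n" using n58 by (intro mult_left_mono) auto
    then show "n + n\<^sup>2 \<le> 2 * n\<^sup>2" by (simp add: power2_eq_square)
  qed (use \<beta> in auto)
  have "c (k, l) = 0" if "k < N" "l < n" for k l
    using coeff_p[of l k] p0[OF that(2)] that(1) by simp
  with c(1) show False by auto
qed

section \<open>Partial recursive programs\<close>

text \<open>Computability is tracked through functions on argument lists of fixed length. The
  closure rules collected in \<open>recfun_intros\<close> then produce the program from the shape of
  a term, and no \<open>recf\<close> expression has to be written for the search itself.\<close>

definition recfun :: "nat \<Rightarrow> (nat list \<Rightarrow> nat) \<Rightarrow> bool" where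
  "recfun n f \<longleftrightarrow> (\<exists>p. \<forall>xs. length xs = n \<longrightarrow> rec_eval p xs (f xs))"

lemma recfun_cong:
  "recfun n f \<Longrightarrow> (\<And>xs. length xs = n \<Longrightarrow> f xs = g xs) \<Longrightarrow> recfun n g"
  unfolding recfun_def by metis

lemma recfun_zero: "recfun n (\<lambda>xs. 0)"
  unfolding recfun_def by (intro exI[of _ Zero]) (simp add: rec_eval.zero)

lemma recfun_var: "i < n \<Longrightarrow> recfun n (\<lambda>xs. xs ! i)"
  unfolding recfun_def by (intro exI[of _ "Proj i"]) (simp add: rec_eval.proj)

lemma recfun_var_drop: "i + k < n \<Longrightarrow> recfun n (\<lambda>xs. drop k xs ! i)"
  using recfun_var[of "k + i" n] by (rule recfun_cong) simp_all

lemma recfun_var_drop2: "i + k + j < n \<Longrightarrow> recfun n (\<lambda>xs. drop k (drop j xs) ! i)"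
  using recfun_var[of "j + k + i" n] by (rule recfun_cong) (simp_all add: add.commute)

lemma recfun_comp:
  assumes g: "recfun (length fs) g" and fs: "\<And>f. f \<in> set fs \<Longrightarrow> recfun n f"
  shows "recfun n (\<lambda>xs. g (map (\<lambda>f. f xs) fs))"
proof -
  obtain q where q: "\<And>xs. length xs = length fs \<Longrightarrow> rec_eval q xs (g xs)"
    using g unfolding recfun_def by blast
  obtain p where p: "\<And>f xs. f \<in> set fs \<Longrightarrow> length xs = n \<Longrightarrow> rec_eval (p f) xs (f xs)"
    using fs unfolding recfun_def by metis
  show ?thesis
    unfolding recfun_def
  proof (intro exI[of _ "Comp q (map p fs)"] allI impI)
    fix xs :: "nat list" assume "length xs = n"
    then show "rec_eval (Comp q (map p fs)) xs (g (map (\<lambda>f. f xs) fs))"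
      by (intro rec_eval.comp[where ys = "map (\<lambda>f. f xs) fs"] q)
         (auto simp: list_all2_conv_all_nth intro: p)
  qed
qed

lemma recfun_comp1:
  assumes "recfun 1 (\<lambda>xs. g (xs ! 0))" "recfun n f"
  shows "recfun n (\<lambda>xs. g (f xs))"
  using recfun_comp[of "[f]" "\<lambda>xs. g (xs ! 0)" n] assms by simp

lemma recfun_comp2:
  assumes "recfun 2 (\<lambda>xs. g (xs ! 0) (xs ! 1))" "recfun n f1" "recfun n f2"
  shows "recfun n (\<lambda>xs. g (f1 xs) (f2 xs))"
  using recfun_comp[of "[f1, f2]" "\<lambda>xs. g (xs ! 0) (xs ! 1)" n] assms
  by (auto simp: numeral_2_eq_2)

lemma recfun_Suc:
  assumes "recfun n f" shows "recfun n (\<lambda>xs. Suc (f xs))"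
proof (rule recfun_comp1[of Suc, OF _ assms])
  show "recfun 1 (\<lambda>xs. Suc (xs ! 0))"
    unfolding recfun_def
    by (intro exI[of _ Succ]) (auto simp: length_Suc_conv intro: rec_eval.succ)
qed

lemma recfun_const: "recfun n (\<lambda>xs. k)"
  by (induction k) (auto intro: recfun_zero recfun_Suc)

lemma recfun_rec:
  assumes h: "recfun n h" and f: "recfun n f"
    and g: "recfun (n + 2) (\<lambda>ys. g (ys ! 0) (ys ! 1) (drop 2 ys))"
  shows "recfun n (\<lambda>xs. rec_nat (f xs) (\<lambda>k acc. g k acc xs) (h xs))"
proof -
  obtain p where p: "\<And>xs. length xs = n \<Longrightarrow> rec_eval p xs (f xs)"
    using f unfolding recfun_def by blast
  obtain q where q: "\<And>xs. length xs = n + 2 \<Longrightarrow> rec_eval q xs (g (xs ! 0) (xs ! 1) (drop 2 xs))"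
    using g unfolding recfun_def by blast
  let ?R = "\<lambda>k xs. rec_nat (f xs) (\<lambda>k acc. g k acc xs) k"
  have R: "rec_eval (PrimRec p q) (k # xs) (?R k xs)" if "length xs = n" for k xs
  proof (induction k)
    case 0
    show ?case using p[OF that] by (auto intro: rec_eval.prim_zero)
  next
    case (Suc k)
    have "rec_eval q (k # ?R k xs # xs) (?R (Suc k) xs)"
      using q[of "k # ?R k xs # xs"] that by simp
    with Suc show ?case by (rule rec_eval.prim_succ)
  qed
  have "recfun (Suc n) (\<lambda>ys. ?R (hd ys) (tl ys))"
    unfolding recfun_def
    by (intro exI[of _ "PrimRec p q"]) (auto simp: length_Suc_conv intro: R)
  then have "recfun n (\<lambda>xs. (\<lambda>ys. ?R (hd ys) (tl ys)) (map (\<lambda>f. f xs) (h # map (\<lambda>i xs. xs ! i) [0..<n])))"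
    by (intro recfun_comp) (auto intro: h recfun_var)
  then show ?thesis
  proof (rule recfun_cong)
    fix xs :: "nat list" assume "length xs = n"
    then have "map ((\<lambda>f. f xs) \<circ> (\<lambda>i xs. xs ! i)) [0..<n] = xs"
      by (intro nth_equalityI) auto
    then show "?R (hd (map (\<lambda>f. f xs) (h # map (\<lambda>i xs. xs ! i) [0..<n])))
       (tl (map (\<lambda>f. f xs) (h # map (\<lambda>i xs. xs ! i) [0..<n]))) = ?R (h xs) xs"
      by simp
  qed
qed

named_theorems recfun_intros

lemmas [recfun_intros] = recfun_const recfun_var recfun_var_drop recfun_var_drop2

lemma recfun_add:
  assumes "recfun n f" "recfun n g" shows "recfun n (\<lambda>xs. f xs + g xs)"
proof (rule recfun_comp2[of "(+)", OF _ assms])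
  have "recfun 2 (\<lambda>xs. rec_nat (xs ! 0) (\<lambda>k acc. Suc acc) (xs ! 1))"
    by (intro recfun_rec recfun_var recfun_Suc) auto
  moreover have "rec_nat x (\<lambda>k acc. Suc acc) y = x + y" for x y
    by (induction y) auto
  ultimately show "recfun 2 (\<lambda>xs. xs ! 0 + xs ! 1)" by simp
qed

lemma recfun_pred:
  assumes "recfun n f" shows "recfun n (\<lambda>xs. f xs - 1)"
proof (rule recfun_comp1[of "\<lambda>x. x - 1", OF _ assms])
  have "recfun 1 (\<lambda>xs. rec_nat 0 (\<lambda>k acc. k) (xs ! 0))"
    by (intro recfun_rec recfun_var recfun_const) auto
  moreover have "rec_nat 0 (\<lambda>k acc. k) y = y - 1" for y :: nat
    by (induction y) auto
  ultimately show "recfun 1 (\<lambda>xs. xs ! 0 - 1)" by simp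
qed

lemma recfun_diff:
  assumes "recfun n f" "recfun n g" shows "recfun n (\<lambda>xs. f xs - g xs)"
proof (rule recfun_comp2[of "(-)", OF _ assms])
  have "recfun 2 (\<lambda>xs. rec_nat (xs ! 0) (\<lambda>k acc. acc - 1) (xs ! 1))"
    by (intro recfun_rec recfun_var recfun_pred) auto
  moreover have "rec_nat x (\<lambda>k acc. acc - 1) y = x - y" for x y :: nat
    by (induction y) auto
  ultimately show "recfun 2 (\<lambda>xs. xs ! 0 - xs ! 1)" by simp
qed

lemma recfun_mult:
  assumes "recfun n f" "recfun n g" shows "recfun n (\<lambda>xs. f xs * g xs)"
proof (rule recfun_comp2[of "(*)", OF _ assms])
  have "recfun 2 (\<lambda>xs. rec_nat 0 (\<lambda>k acc. acc + xs ! 0) (xs ! 1))"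
    by (intro recfun_rec recfun_intros recfun_add) auto
  moreover have "rec_nat 0 (\<lambda>k acc. acc + x) y = x * y" for x y :: nat
    by (induction y) auto
  ultimately show "recfun 2 (\<lambda>xs. xs ! 0 * xs ! 1)" by simp
qed

lemma recfun_power:
  assumes "recfun n f" "recfun n g" shows "recfun n (\<lambda>xs. f xs ^ g xs)"
proof (rule recfun_comp2[of "(^)", OF _ assms])
  have "recfun 2 (\<lambda>xs. rec_nat 1 (\<lambda>k acc. acc * xs ! 0) (xs ! 1))"
    by (intro recfun_rec recfun_intros recfun_mult) auto
  moreover have "rec_nat 1 (\<lambda>k acc. acc * x) y = x ^ y" for x y :: nat
    by (induction y) auto
  ultimately show "recfun 2 (\<lambda>xs. xs ! 0 ^ xs ! 1)" by simp
qed

text \<open>The body has arity \<open>n + 2\<close>, as for \<open>recfun_rec\<close>: position 1 is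
  the accumulator and is skipped. Counting and bounded quantification are reduced to such
  sums.\<close>

lemma recfun_sum:
  assumes h: "recfun n h" and g: "recfun (n + 2) (\<lambda>ys. g (ys ! 0) (drop 2 ys))"
  shows "recfun n (\<lambda>xs. \<Sum>k<h xs. g k xs)"
proof -
  have "recfun n (\<lambda>xs. rec_nat 0 (\<lambda>k acc. acc + g k xs) (h xs))"
    by (intro recfun_rec recfun_intros recfun_add h g) auto
  moreover have "rec_nat 0 (\<lambda>k acc. acc + g k xs) y = (\<Sum>k<y. g k xs)" for xs y
    by (induction y) auto
  ultimately show ?thesis by simp
qed

lemmas [recfun_intros] = recfun_Suc recfun_add recfun_diff recfun_mult recfun_power recfun_sum

section \<open>Predicates, counting and bounded quantifiers\<close>

lemma recfun_not:
  assumes "recfun n (\<lambda>xs. of_bool (P xs))" shows "recfun n (\<lambda>xs. of_bool (\<not> P xs))"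
proof -
  have "recfun n (\<lambda>xs. 1 - of_bool (P xs))" by (intro recfun_intros assms)
  then show ?thesis by (rule recfun_cong) auto
qed

lemma recfun_conj:
  assumes "recfun n (\<lambda>xs. of_bool (P xs))" "recfun n (\<lambda>xs. of_bool (Q xs))"
  shows "recfun n (\<lambda>xs. of_bool (P xs \<and> Q xs))"
proof -
  have "recfun n (\<lambda>xs. of_bool (P xs) * of_bool (Q xs))" by (intro recfun_intros assms)
  then show ?thesis by (rule recfun_cong) auto
qed

lemma recfun_eq_0:
  assumes "recfun n f" shows "recfun n (\<lambda>xs. of_bool (f xs = 0))"
proof -
  have "recfun n (\<lambda>xs. 1 - f xs)" by (intro recfun_intros assms)
  then show ?thesis by (rule recfun_cong) auto
qed

lemma recfun_le:
  assumes "recfun n f" "recfun n g" shows "recfun n (\<lambda>xs. of_bool (f xs \<le> g xs))"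
proof -
  have "recfun n (\<lambda>xs. of_bool (f xs - g xs = 0))" by (intro recfun_intros recfun_eq_0 assms)
  then show ?thesis by (rule recfun_cong) auto
qed

lemma recfun_less:
  assumes "recfun n f" "recfun n g" shows "recfun n (\<lambda>xs. of_bool (f xs < g xs))"
proof -
  have "recfun n (\<lambda>xs. of_bool (Suc (f xs) \<le> g xs))" by (intro recfun_intros recfun_le assms)
  then show ?thesis by (simp add: Suc_le_eq)
qed

lemma recfun_eq:
  assumes "recfun n f" "recfun n g" shows "recfun n (\<lambda>xs. of_bool (f xs = g xs))"
proof -
  have "recfun n (\<lambda>xs. of_bool (f xs \<le> g xs \<and> g xs \<le> f xs))"
    by (intro recfun_intros recfun_conj recfun_le assms)
  then show ?thesis by (simp add: eq_iff)
qed

lemmas [recfun_intros] = recfun_not recfun_conj recfun_le recfun_less recfun_eq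

lemma recfun_If:
  assumes "recfun n (\<lambda>xs. of_bool (P xs))" "recfun n f" "recfun n g"
  shows "recfun n (\<lambda>xs. if P xs then f xs else g xs)"
proof -
  have "recfun n (\<lambda>xs. of_bool (P xs) * f xs + of_bool (\<not> P xs) * g xs)"
    by (intro recfun_intros assms)
  then show ?thesis by (rule recfun_cong) auto
qed

lemma recfun_card:
  assumes "recfun n h" "recfun (n + 2) (\<lambda>ys. of_bool (P (ys ! 0) (drop 2 ys)))"
  shows "recfun n (\<lambda>xs. card {k. k < h xs \<and> P k xs})"
proof -
  have "recfun n (\<lambda>xs. \<Sum>k<h xs. of_bool (P k xs))" by (intro recfun_intros assms)
  then show ?thesis
  proof (rule recfun_cong)
    fix xs
    have "(\<Sum>k<h xs. of_bool (P k xs)) = card ({..<h xs} \<inter> {k. P k xs})"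
      by (subst sum_of_bool_eq) simp_all
    also have "{..<h xs} \<inter> {k. P k xs} = {k. k < h xs \<and> P k xs}" by auto
    finally show "(\<Sum>k<h xs. of_bool (P k xs)) = card {k. k < h xs \<and> P k xs}" .
  qed
qed

lemma recfun_all:
  assumes "recfun n h" "recfun (n + 2) (\<lambda>ys. of_bool (P (ys ! 0) (drop 2 ys)))"
  shows "recfun n (\<lambda>xs. of_bool (\<forall>k<h xs. P k xs))"
proof -
  have "recfun n (\<lambda>xs. of_bool ((\<Sum>k<h xs. of_bool (\<not> P k xs) :: nat) = 0))"
    by (intro recfun_intros assms)
  then show ?thesis by (rule recfun_cong) auto
qed

lemmas [recfun_intros] = recfun_If recfun_card recfun_all

lemma recfun_div:
  assumes "recfun n f" "recfun n g" shows "recfun n (\<lambda>xs. f xs div g xs)"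
proof (rule recfun_comp2[of "(div)", OF _ assms])
  \<comment> \<open>The quotient is the number of \<open>k\<close> with
    \<open>(k + 1) * y \<le> x\<close>; the condition \<open>0 < y\<close> makes the count 0 for
    \<open>y = 0\<close>, in agreement with \<open>x div 0 = 0\<close>.\<close>
  have "recfun 2 (\<lambda>xs. card {k. k < xs ! 0 \<and> (0 < xs ! 1 \<and> Suc k * xs ! 1 \<le> xs ! 0)})"
    by (intro recfun_intros) auto
  then show "recfun 2 (\<lambda>xs. xs ! 0 div xs ! 1)"
  proof (rule recfun_cong)
    fix xs :: "nat list"
    let ?x = "xs ! 0" and ?y = "xs ! 1"
    have "{k. k < ?x \<and> (0 < ?y \<and> Suc k * ?y \<le> ?x)} = {..<?x div ?y}" if y: "0 < ?y"
    proof (intro equalityI subsetI)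
      fix k assume "k \<in> {k. k < ?x \<and> (0 < ?y \<and> Suc k * ?y \<le> ?x)}"
      then show "k \<in> {..<?x div ?y}" using y by (simp add: less_eq_div_iff_mult_less_eq flip: Suc_le_eq)
    next
      fix k assume "k \<in> {..<?x div ?y}"
      then have "Suc k \<le> ?x div ?y" by simp
      with y have "Suc k * ?y \<le> ?x" by (simp add: less_eq_div_iff_mult_less_eq del: mult_Suc)
      moreover from \<open>Suc k \<le> ?x div ?y\<close> have "k < ?x"
        using div_le_dividend[of ?x ?y] by linarith
      ultimately show "k \<in> {k. k < ?x \<and> (0 < ?y \<and> Suc k * ?y \<le> ?x)}" using y by simp
    qed
    then show "card {k. k < ?x \<and> (0 < ?y \<and> Suc k * ?y \<le> ?x)} = ?x div ?y"
      by (cases "0 < ?y") auto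
  qed
qed

lemma recfun_mod:
  assumes "recfun n f" "recfun n g" shows "recfun n (\<lambda>xs. f xs mod g xs)"
proof -
  have "recfun n (\<lambda>xs. f xs - f xs div g xs * g xs)" by (intro recfun_intros recfun_div assms)
  then show ?thesis by (simp add: minus_div_mult_eq_mod)
qed

lemma recfun_prod_encode:
  assumes "recfun n f" "recfun n g" shows "recfun n (\<lambda>xs. prod_encode (f xs, g xs))"
  unfolding prod_encode_def triangle_def split_conv
  by (intro recfun_intros recfun_div assms)

lemmas [recfun_intros] = recfun_div recfun_mod recfun_prod_encode

text \<open>
  The non-multiple of \<open>b\<close> with index \<open>j\<close>, counted from 0 among all non-multiples, is
  \<open>j + 1 + j div (b - 1)\<close>; in this form the map does not depend on \<open>a\<close> and \<open>c\<close>.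
\<close>

definition collapsed_map :: "nat \<Rightarrow> nat \<Rightarrow> nat \<Rightarrow> nat" where
  "collapsed_map b d x = (if x mod b = 0 then d * (x div b)
     else Suc (x - 1 - x div b + (x - 1 - x div b) div (d - 1)))"

lemma recfun_collapsed_map [recfun_intros]:
  assumes "recfun n f" "recfun n g" "recfun n h"
  shows "recfun n (\<lambda>xs. collapsed_map (f xs) (g xs) (h xs))"
  unfolding collapsed_map_def by (intro recfun_intros assms)

lemma recfun_iterate [recfun_intros]:
  assumes "recfun n b" "recfun n d" "recfun n f" "recfun n h"
  shows "recfun n (\<lambda>xs. (collapsed_map (b xs) (d xs) ^^ h xs) (f xs))"
proof -
  have "recfun (3 + 1) (\<lambda>xs. rec_nat (xs ! 0) (\<lambda>k acc. collapsed_map (xs ! 1) (xs ! 2) acc) (xs ! 3))"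
    by (intro recfun_rec recfun_intros) auto
  moreover have "rec_nat x (\<lambda>k acc. collapsed_map b d acc) k = (collapsed_map b d ^^ k) x" for x b d k
    by (induction k) auto
  ultimately have "recfun 4 (\<lambda>xs. (collapsed_map (xs ! 1) (xs ! 2) ^^ (xs ! 3)) (xs ! 0))" by simp
  then show ?thesis
    using recfun_comp[of "[f, b, d, h]" "\<lambda>xs. (collapsed_map (xs ! 1) (xs ! 2) ^^ (xs ! 3)) (xs ! 0)" n] assms
    by (auto simp: numeral_eq_Suc)
qed

section \<open>Cycles as orbits, and their enumeration by a program\<close>

definition orbit :: "(nat \<Rightarrow> nat) \<Rightarrow> nat \<Rightarrow> nat \<Rightarrow> nat list" where
  "orbit f p x = map (\<lambda>i. (f ^^ i) x) [0..<p]"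

text \<open>\<open>list_encode\<close> wraps a new element around the code of the tail, so primitive
  recursion has to build the list from its last element backwards.\<close>

lemma list_encode_orbit:
  "list_encode (orbit f p x) = rec_nat 0 (\<lambda>k acc. Suc (prod_encode ((f ^^ (p - Suc k)) x, acc))) p"
proof -
  have "rec_nat 0 (\<lambda>k acc. Suc (prod_encode ((f ^^ (p - Suc k)) x, acc))) k
     = list_encode (map (\<lambda>i. (f ^^ i) x) [p - k..<p])" if "k \<le> p" for k
    using that
  proof (induction k)
    case (Suc k)
    then have "[p - Suc k..<p] = (p - Suc k) # [p - k..<p]"
      by (subst upt_conv_Cons) (auto simp: Suc_diff_Suc)
    with Suc show ?case by simp
  qed simp
  from this[of p] show ?thesis by (simp add: orbit_def)
qed

definition is_m_orbit :: "(nat \<Rightarrow> nat) \<Rightarrow> nat \<Rightarrow> nat \<Rightarrow> nat \<Rightarrow> bool" where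
  "is_m_orbit f m p x \<longleftrightarrow> 0 < p \<and> (f ^^ p) x = x \<and>
     (\<forall>i<p. \<forall>j<i. \<not> (f ^^ i) x = (f ^^ j) x) \<and>
     card {i. i < p \<and> ((f ^^ i) x < (f ^^ ((i + p - 1) mod p)) x \<and> (f ^^ i) x < (f ^^ ((i + 1) mod p)) x)} = m \<and>
     card {i. i < p \<and> ((f ^^ ((i + p - 1) mod p)) x < (f ^^ i) x \<and> (f ^^ ((i + 1) mod p)) x < (f ^^ i) x)} = m"

text \<open>A cycle is the orbit of its head, so the search over lists becomes one over pairs
  \<open>(p, x)\<close>. The different rotations of a cycle are different lists and correspond to
  the choices of \<open>x\<close>.\<close>

lemma m_cycles_eq_orbits: "m_cycles f m = {orbit f p x |p x. is_m_orbit f m p x}"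
proof -
  have cyc: "xs = orbit f (length xs) (hd xs)" "(f ^^ length xs) (hd xs) = hd xs"
    if "is_cycle f xs" for xs
  proof -
    from that have ne: "xs \<noteq> []" and step: "\<And>i. i < length xs \<Longrightarrow> f (xs ! i) = xs ! ((i + 1) mod length xs)"
      by (auto simp: is_cycle_def)
    have it: "(f ^^ i) (hd xs) = xs ! (i mod length xs)" for i
    proof (induction i)
      case 0
      show ?case using ne by (simp add: hd_conv_nth)
    next
      case (Suc i)
      have "(f ^^ Suc i) (hd xs) = f (xs ! (i mod length xs))" using Suc by simp
      also have "\<dots> = xs ! (Suc i mod length xs)"
        using step[of "i mod length xs"] ne by (simp add: mod_Suc_eq)
      finally show ?case .
    qed
    show "xs = orbit f (length xs) (hd xs)"
      by (rule nth_equalityI) (auto simp: orbit_def it)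
    show "(f ^^ length xs) (hd xs) = hd xs"
      using ne it[of "length xs"] by (simp add: hd_conv_nth)
  qed
  have iff: "orbit f p x \<in> m_cycles f m \<longleftrightarrow> is_m_orbit f m p x"
    if per: "(f ^^ p) x = x" for p x
  proof (cases "p = 0")
    case True
    then show ?thesis by (simp add: m_cycles_def is_cycle_def is_m_orbit_def orbit_def)
  next
    case False
    then have p: "0 < p" by simp
    have step: "f ((f ^^ i) x) = (f ^^ ((i + 1) mod p)) x" if "i < p" for i
    proof (cases "i + 1 = p")
      case True
      with per show ?thesis by auto
    next
      case False
      with that show ?thesis by auto
    qed
    have "is_cycle f (orbit f p x) \<longleftrightarrow> (\<forall>i<p. \<forall>j<i. \<not> (f ^^ i) x = (f ^^ j) x)"
    proof -
      have "is_cycle f (orbit f p x) \<longleftrightarrow> distinct (orbit f p x)"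
        using p step unfolding is_cycle_def by (auto simp: orbit_def)
      also have "\<dots> \<longleftrightarrow> (\<forall>i<p. \<forall>j<p. i \<noteq> j \<longrightarrow> (f ^^ i) x \<noteq> (f ^^ j) x)"
        by (auto simp: orbit_def distinct_conv_nth)
      also have "\<dots> \<longleftrightarrow> (\<forall>i<p. \<forall>j<i. \<not> (f ^^ i) x = (f ^^ j) x)"
        by (metis less_trans linorder_neq_iff)
      finally show ?thesis .
    qed
    moreover have "local_minima (orbit f p x) = {i. i < p \<and> ((f ^^ i) x < (f ^^ ((i + p - 1) mod p)) x \<and> (f ^^ i) x < (f ^^ ((i + 1) mod p)) x)}"
      using p by (auto simp: local_minima_def orbit_def)
    moreover have "local_maxima (orbit f p x) = {i. i < p \<and> ((f ^^ ((i + p - 1) mod p)) x < (f ^^ i) x \<and> (f ^^ ((i + 1) mod p)) x < (f ^^ i) x)}"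
      using p by (auto simp: local_maxima_def orbit_def)
    ultimately show ?thesis using p per by (simp add: m_cycles_def is_m_orbit_def)
  qed
  show ?thesis
  proof (intro equalityI subsetI)
    fix xs assume xs: "xs \<in> m_cycles f m"
    then have "is_cycle f xs" by (simp add: m_cycles_def)
    from cyc[OF this] xs iff show "xs \<in> {orbit f p x |p x. is_m_orbit f m p x}"
      by (smt (verit, best) mem_Collect_eq)
  next
    fix xs assume "xs \<in> {orbit f p x |p x. is_m_orbit f m p x}"
    then show "xs \<in> m_cycles f m" using iff by (auto simp: is_m_orbit_def)
  qed
qed

lemma recfun_is_m_orbit [recfun_intros]:
  assumes "recfun n b" "recfun n d" "recfun n m" "recfun n p" "recfun n f"
  shows "recfun n (\<lambda>xs. of_bool (is_m_orbit (collapsed_map (b xs) (d xs)) (m xs) (p xs) (f xs)))"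
proof -
  have "recfun 5 (\<lambda>xs. of_bool (is_m_orbit (collapsed_map (xs ! 0) (xs ! 1)) (xs ! 2) (xs ! 3) (xs ! 4)))"
    unfolding is_m_orbit_def by (intro recfun_intros) auto
  then show ?thesis
    using recfun_comp[of "[b, d, m, p, f]" "\<lambda>xs. of_bool (is_m_orbit (collapsed_map (xs ! 0) (xs ! 1)) (xs ! 2) (xs ! 3) (xs ! 4))" n] assms
    by (auto simp: numeral_eq_Suc)
qed

lemma recfun_list_encode_orbit [recfun_intros]:
  assumes "recfun n b" "recfun n d" "recfun n p" "recfun n f"
  shows "recfun n (\<lambda>xs. list_encode (orbit (collapsed_map (b xs) (d xs)) (p xs) (f xs)))"
proof -
  have "recfun 4 (\<lambda>xs. list_encode (orbit (collapsed_map (xs ! 0) (xs ! 1)) (xs ! 2) (xs ! 3)))"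
    unfolding list_encode_orbit by (intro recfun_rec recfun_intros) auto
  then show ?thesis
    using recfun_comp[of "[b, d, p, f]" "\<lambda>xs. list_encode (orbit (collapsed_map (xs ! 0) (xs ! 1)) (xs ! 2) (xs ! 3))" n] assms
    by (auto simp: numeral_eq_Suc)
qed

text \<open>The counter \<open>k\<close> codes the pair of length \<open>k div B\<close> and start
  \<open>k mod B\<close>, so that a single recursion searches all pairs.\<close>

fun bounded_m_cycles :: "nat \<Rightarrow> nat \<Rightarrow> nat \<Rightarrow> nat \<Rightarrow> nat \<Rightarrow> nat list list" where
  "bounded_m_cycles b d m B 0 = []"
| "bounded_m_cycles b d m B (Suc k) =
    (if is_m_orbit (collapsed_map b d) m (k div B) (k mod B)
     then [orbit (collapsed_map b d) (k div B) (k mod B)] else []) @ bounded_m_cycles b d m B k"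

lemma set_bounded_m_cycles:
  "set (bounded_m_cycles b d m B k) = {orbit (collapsed_map b d) (i div B) (i mod B) |i.
     i < k \<and> is_m_orbit (collapsed_map b d) m (i div B) (i mod B)}"
  by (induction k) (auto simp: less_Suc_eq)

lemma recfun_bounded_m_cycles:
  assumes "recfun n b" "recfun n d" "recfun n m" "recfun n B" "recfun n k"
  shows "recfun n (\<lambda>xs. list_encode (map list_encode (bounded_m_cycles (b xs) (d xs) (m xs) (B xs) (k xs))))"
proof -
  have eq: "list_encode (map list_encode (bounded_m_cycles b d m B k)) =
     rec_nat 0 (\<lambda>k acc. if is_m_orbit (collapsed_map b d) m (k div B) (k mod B)
        then Suc (prod_encode (list_encode (orbit (collapsed_map b d) (k div B) (k mod B)), acc)) else acc) k"
    for b d m B k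
    by (induction k) auto
  have "recfun 5 (\<lambda>xs. list_encode (map list_encode (bounded_m_cycles (xs ! 0) (xs ! 1) (xs ! 2) (xs ! 3) (xs ! 4))))"
    unfolding eq by (intro recfun_rec recfun_intros) auto
  then show ?thesis
    using recfun_comp[of "[b, d, m, B, k]" "\<lambda>xs. list_encode (map list_encode (bounded_m_cycles (xs ! 0) (xs ! 1) (xs ! 2) (xs ! 3) (xs ! 4)))" n] assms
    by (auto simp: numeral_eq_Suc)
qed

section \<open>Increasing and decreasing runs\<close>

lemma length_filter_not_dvd:
  assumes "0 < b"
  shows "length (filter (\<lambda>r. \<not> b dvd r) [1..<Suc k]) = k - k div b"
proof (induction k)
  case (Suc k)
  have "k div b \<le> k" by simp
  with Suc show ?case by (auto simp: div_Suc Suc_diff_le dvd_eq_mod_eq_0)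
qed simp

text \<open>Writing \<open>x = b * q + e + 1\<close> with \<open>e < b - 1\<close>, the index
  \<open>x - 1 - x div b\<close> is \<open>(b - 1) * q + e\<close>, and its quotient by
  \<open>b - 1\<close> recovers \<open>q\<close>.\<close>

lemma Suc_index_div:
  fixes x b :: nat
  assumes "1 < b" "\<not> b dvd x"
  shows "x = Suc (x - 1 - x div b + (x - 1 - x div b) div (b - 1))"
proof -
  define q where "q = x div b"
  define e where "e = x mod b - 1"
  have "x mod b \<noteq> 0" using assms by (simp add: dvd_eq_mod_eq_0)
  moreover have "x mod b < b" using assms by simp
  ultimately have e: "x mod b = Suc e" "e < b - 1"
    by (auto simp: e_def)
  have x: "x = b * q + Suc e" using e by (metis q_def mult_div_mod_eq)
  obtain b' where b': "b = Suc b'" using assms by (cases b) auto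
  have "x - 1 - x div b = e + q * b'" unfolding q_def[symmetric] by (simp add: x b')
  moreover have "(e + q * b') div b' = q" using e b' by simp
  ultimately show ?thesis by (simp add: x b')
qed

lemma nonmultiples_nth:
  assumes b: "1 < b" and i: "i < length (nonmultiples a b)"
  defines "r \<equiv> nonmultiples a b ! i"
  shows "r = Suc (i + i div (b - 1))" "i = r - 1 - r div b"
proof -
  have r: "1 \<le> r" "\<not> b dvd r"
    using nth_mem[OF i] unfolding set_nonmultiples r_def[symmetric] by auto
  then obtain k where k: "r = Suc k" by (cases r) auto
  have "k - k div b = i"
    using nonmultiples_index[OF i] length_filter_not_dvd[of b k] b
    unfolding r_def[symmetric] k by simp
  moreover have "k div b = r div b" using r by (simp add: k div_Suc dvd_eq_mod_eq_0)
  ultimately show i: "i = r - 1 - r div b" by (simp add: k)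
  show "r = Suc (i + i div (b - 1))"
    unfolding i using Suc_index_div[OF b r(2)] .
qed

text \<open>A shift by one period raises the global index of a non-multiple by
  \<open>a * (b - 1)\<close> in the domain and by \<open>c * (d - 1)\<close> in the range. Their
  equality says that the map preserves the global index.\<close>

lemma P_map_eq_collapsed_map:
  assumes "0 < a" "1 < b" "0 < c" "1 < d" and N: "a * (b - 1) = c * (d - 1)"
  shows "P_map a b c d = collapsed_map b d"
proof (rule P_map_unique[symmetric])
  show "collapsed_map b d (b * n) = d * n" for n
    using assms by (simp add: collapsed_map_def)
  fix n i assume i: "i < length (nonmultiples a b)"
  have i': "i < length (nonmultiples c d)"
    using i assms by (simp add: length_nonmultiples)
  define r where "r = nonmultiples a b ! i"
  define s where "s = nonmultiples c d ! i"
  note r = nonmultiples_nth[OF assms(2) i, folded r_def]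
  note s = nonmultiples_nth[OF assms(4) i', folded s_def]
  have "\<not> b dvd r" using nth_mem[OF i] by (simp add: set_nonmultiples r_def)
  then have nd: "\<not> b dvd a * b * n + r" by (simp add: dvd_add_right_iff)
  have "(a * b * n + r) div b = a * n + r div b"
    using assms(2) by (simp add: mult.assoc mult.left_commute[of a b])
  moreover obtain b' where b': "b = Suc b'" using assms(2) by (cases b) auto
  moreover have "r div b \<le> r - 1"
  proof -
    have "r \<noteq> 0" using \<open>\<not> b dvd r\<close> by (intro notI) simp
    then have "r div b < r" using assms(2) by (intro div_less_dividend) auto
    then show ?thesis by simp
  qed
  moreover have "r \<noteq> 0" using \<open>\<not> b dvd r\<close> by (intro notI) simp
  ultimately have "a * b * n + r - 1 - (a * b * n + r) div b = a * (b - 1) * n + (r - 1 - r div b)"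
    by (simp add: algebra_simps)
  then have J: "a * b * n + r - 1 - (a * b * n + r) div b = c * n * (d - 1) + i"
    unfolding r(2)[symmetric] N by (simp add: mult_ac)
  have "(c * n * (d - 1) + i) div (d - 1) = c * n + i div (d - 1)"
    using assms(4) by simp
  moreover obtain d' where "d = Suc d'" using assms(4) by (cases d) auto
  ultimately have "Suc (c * n * (d - 1) + i + (c * n * (d - 1) + i) div (d - 1)) = c * d * n + s"
    using s(1) by (simp add: algebra_simps)
  with nd J show "collapsed_map b d (a * b * n + nonmultiples a b ! i) = c * d * n + nonmultiples c d ! i"
    by (simp add: collapsed_map_def r_def s_def dvd_eq_mod_eq_0)
qed (use assms in auto)

text \<open>With \<open>J\<close> the index of \<open>x\<close>, and \<open>y\<close> the image of
  \<open>x\<close>, \<open>(b - 1) * x\<close> equals \<open>b * J\<close> and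
  \<open>(d - 1) * y\<close> equals \<open>d * J\<close> up to remainders. Eliminating
  \<open>J\<close> leaves the difference of two numbers in \<open>[0, b * (d - 1)]\<close>, and
  division by \<open>b * (d - 1)\<close> gives the error 1.\<close>

lemma collapsed_map_nonmultiple:
  assumes b: "1 < b" "b \<le> d" and x: "\<not> b dvd x"
  shows "collapsed_map b d x \<le> x"
    and "\<bar>real (collapsed_map b d x) - real (d * (b - 1)) / real (b * (d - 1)) * x\<bar> \<le> 1"
proof -
  define J where "J = x - 1 - x div b"
  have xJ: "x = Suc (J + J div (b - 1))" unfolding J_def by (rule Suc_index_div[OF b(1) x])
  define y where "y = collapsed_map b d x"
  have yJ: "y = Suc (J + J div (d - 1))"
    using x by (simp add: y_def collapsed_map_def J_def dvd_eq_mod_eq_0)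
  have "J div (d - 1) \<le> J div (b - 1)" using b by (intro div_le_mono2) auto
  then show "collapsed_map b d x \<le> x" using xJ yJ by (simp add: y_def)
  obtain b' d' where bd: "b = Suc b'" "d = Suc d'" using b by (cases b; cases d) auto
  have pos: "0 < b'" "b' \<le> d'" using b bd by auto
  define u where "u = J mod b'"
  define v where "v = J mod d'"
  have u: "u < b'" and v: "v < d'" using pos by (auto simp: u_def v_def)
  have eqx: "b' * x + u = b * J + b'" and eqy: "d' * y + v = d * J + d'"
    using mult_div_mod_eq[of b' J] mult_div_mod_eq[of d' J]
    by (simp_all add: xJ yJ bd u_def v_def algebra_simps)
  have eqx': "real b' * x = real b * J + real b' - real u"
    and eqy': "real d' * y = real d * J + real d' - real v"
    using arg_cong[OF eqx, of real] arg_cong[OF eqy, of real] by simp_all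
  have "real d' * b * y - real d * b' * x = b * (real d' * y) - d * (real b' * x)" by (simp add: mult_ac)
  also have "\<dots> = b * (d' - real v) - d * (b' - real u)"
    unfolding eqx' eqy' by (simp add: algebra_simps)
  finally have diff: "real d' * b * y - real d * b' * x = b * (d' - real v) - d * (b' - real u)" .
  have "b * (d' - real v) \<le> b * real d'" by (intro mult_left_mono) auto
  moreover have "0 \<le> b * (d' - real v)" using v by (intro mult_nonneg_nonneg) auto
  moreover have "d * (b' - real u) \<le> d * real b'" by (intro mult_left_mono) auto
  moreover have "0 \<le> d * (b' - real u)" using u by (intro mult_nonneg_nonneg) auto
  moreover have "d * real b' \<le> b * real d'" using pos by (simp add: bd algebra_simps)
  ultimately have "\<bar>real d' * b * y - real d * b' * x\<bar> \<le> b * real d'" unfolding diff by linarith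
  then have "\<bar>real d' * b * y - real d * b' * x\<bar> / (b * real d') \<le> 1"
    using pos bd by (simp add: divide_le_eq)
  moreover have "real y - real (d * (b - 1)) / real (b * (d - 1)) * x
      = (real d' * b * y - real d * b' * x) / (b * real d')"
  proof -
    have "0 < real b" "0 < real d'" "real (b - 1) = b'" "real (d - 1) = d'" using pos bd by auto
    then show ?thesis by (simp add: diff_divide_distrib mult_ac)
  qed
  ultimately show "\<bar>real (collapsed_map b d x) - real (d * (b - 1)) / real (b * (d - 1)) * x\<bar> \<le> 1"
    using pos bd by (simp add: y_def abs_divide)
qed

lemma power_le_power_power:
  fixes b d u :: nat
  assumes "2 \<le> b" "0 < u" "0 < d"
  shows "d ^ t * u \<le> (b ^ t * u) ^ d"
proof -
  have "d \<le> 2 ^ d" by (simp add: less_imp_le)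
  also have "\<dots> \<le> b ^ d" using assms by (intro power_mono) auto
  finally have "d ^ t \<le> (b ^ d) ^ t" by (intro power_mono) auto
  moreover have "u \<le> u ^ d" using assms by (simp add: self_le_power)
  ultimately have "d ^ t * u \<le> (b ^ d) ^ t * u ^ d" by (intro mult_mono) auto
  also have "\<dots> = (b ^ t * u) ^ d"
    by (simp add: power_mult_distrib flip: power_mult) (simp add: mult.commute)
  finally show ?thesis .
qed

text \<open>
  Within an increasing run starting at \<open>z\<close> the \<open>t\<close>-th term is \<open>z * (d / b) ^ t\<close>, so
  \<open>z = b ^ t * u\<close> and the run ends below \<open>z ^ d\<close>. Hence \<open>m\<close> runs raise the size of the
  terms at most to the power \<open>d ^ m\<close>.
\<close>

lemma runs_growth:
  fixes g :: "nat \<Rightarrow> nat" and E :: "nat \<Rightarrow> bool"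
  assumes bd: "2 \<le> b" "0 < d" "coprime b d"
    and E: "\<And>i. E i \<Longrightarrow> b * g (Suc i) = d * g i"
    and A: "\<And>i. \<not> E i \<Longrightarrow> g (Suc i) \<le> g i" and pos: "\<And>i. 0 < g i"
    and count: "card {t \<in> {s<..<s + p}. \<not> E (t - 1) \<and> E t} < m" and i: "i < p"
  defines "W \<equiv> g s ^ d ^ m"
  shows "g (s + i) \<le> W" "2 ^ card {t \<in> {s..<s + i}. E t} \<le> W ^ m"
proof -
  let ?X = "g s"
  \<comment> \<open>\<open>j\<close> counts the runs begun after \<open>s\<close>. Its strict bound
    by \<open>m\<close> leaves one more power of \<open>d\<close> for the end of the current
    run.\<close>
  define j where "j = (\<lambda>i. card {t \<in> {s<..<s + i}. \<not> E (t - 1) \<and> E t})"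
  define e where "e = (\<lambda>i. card {t \<in> {s..<s + i}. E t})"
  have jm: "j i < m" if "i < p" for i
  proof -
    have "j i \<le> j p" unfolding j_def using that by (intro card_mono) auto
    with count show ?thesis by (simp add: j_def)
  qed
  have W: "?X ^ d ^ k \<le> W" if "k \<le> m" for k
    unfolding W_def using pos[of s] bd that by (intro power_increasing) auto
  have W1: "1 \<le> W" using pos[of s] by (simp add: W_def Suc_leI)
  \<comment> \<open>The latest run started at \<open>b ^ t * u\<close> and has made \<open>t\<close>
    exact steps. Equality with \<open>d ^ t * u\<close> holds while it lasts; afterwards only the
    inequality survives the decreasing steps. Each earlier run accounts for a factor
    \<open>W\<close> in the bound for \<open>2 ^ e i\<close>.\<close>
  have inv: "\<exists>t u. 0 < u \<and> b ^ t * u \<le> ?X ^ d ^ j i \<and> g (s + i) \<le> d ^ t * u \<and>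
      (i = 0 \<or> E (s + i - 1) \<longrightarrow> g (s + i) = d ^ t * u) \<and> 2 ^ e i \<le> 2 ^ t * W ^ j i"
    if "i < p" for i
    using that
  proof (induction i)
    case 0
    have "j 0 = 0" "e 0 = 0" by (simp_all add: j_def e_def)
    then show ?case by - (rule exI[of _ 0], rule exI[of _ ?X], simp add: pos)
  next
    case (Suc i)
    then obtain t u where tu: "0 < u" "b ^ t * u \<le> ?X ^ d ^ j i" "g (s + i) \<le> d ^ t * u"
       "i = 0 \<or> E (s + i - 1) \<Longrightarrow> g (s + i) = d ^ t * u" "2 ^ e i \<le> 2 ^ t * W ^ j i"
      by auto
    have split_e: "e (Suc i) = e i + (if E (s + i) then 1 else 0)"
    proof -
      have "{t \<in> {s..<s + Suc i}. E t} = {t \<in> {s..<s + i}. E t} \<union> (if E (s + i) then {s + i} else {})"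
        by (auto simp: less_Suc_eq)
      then show ?thesis by (auto simp: e_def)
    qed
    have split_j: "j (Suc i) = j i + (if i \<noteq> 0 \<and> \<not> E (s + i - 1) \<and> E (s + i) then 1 else 0)"
    proof -
      have "{t \<in> {s<..<s + Suc i}. \<not> E (t - 1) \<and> E t} = {t \<in> {s<..<s + i}. \<not> E (t - 1) \<and> E t} \<union>
         (if i \<noteq> 0 \<and> \<not> E (s + i - 1) \<and> E (s + i) then {s + i} else {})"
        by (auto simp: less_Suc_eq)
      then show ?thesis by (auto simp: j_def)
    qed
    show ?case
    proof (cases "E (s + i)")
      case False
      then have "g (s + Suc i) \<le> d ^ t * u" using A[of "s + i"] tu(3) by simp
      with False tu show ?thesis
        by - (rule exI[of _ t], rule exI[of _ u], auto simp: split_e split_j)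
    next
      case True
      have step: "b * g (s + Suc i) = d * g (s + i)" using E[OF True] by simp
      then have "b dvd d * g (s + i)" by (metis dvd_triv_left)
      then have dv: "b dvd g (s + i)" using bd(3) by (simp add: coprime_dvd_mult_right_iff)
      show ?thesis
      proof (cases "i = 0 \<or> E (s + i - 1)")
        case True': True
        then have g: "g (s + i) = d ^ t * u" by (rule tu(4))
        \<comment> \<open>Coprimality carries divisibility by \<open>b\<close> from the term
          \<open>d ^ t * u\<close> over to \<open>u\<close>, so every further step of a run extracts
          one more factor \<open>b\<close> of its start.\<close>
        have "b dvd u" using dv bd(3) by (simp add: g coprime_dvd_mult_right_iff)
        then obtain v where v: "u = b * v" by (rule dvdE)
        have "b * g (s + Suc i) = b * (d ^ Suc t * v)" unfolding step g v by (simp add: mult_ac)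
        then have "g (s + Suc i) = d ^ Suc t * v" using bd(1) by simp
        moreover have "b ^ Suc t * v \<le> ?X ^ d ^ j i" using tu(2) by (simp add: v mult_ac)
        moreover have "0 < v" using tu(1) v by simp
        moreover have "j (Suc i) = j i" using True' by (auto simp: split_j)
        ultimately show ?thesis
          using tu(5) True by - (rule exI[of _ "Suc t"], rule exI[of _ v], simp add: split_e)
      next
        case False
        from dv obtain v where v: "g (s + i) = b * v" by (rule dvdE)
        have "b * g (s + Suc i) = b * (d * v)" unfolding step v by (simp add: mult_ac)
        then have "g (s + Suc i) = d ^ 1 * v" using bd(1) by simp
        moreover have "0 < v" using pos[of "s + i"] v by simp
        moreover have jS: "j (Suc i) = Suc (j i)" using False True by (simp add: split_j)
        moreover have "b ^ 1 * v \<le> ?X ^ d ^ Suc (j i)"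
        proof -
          have "b ^ 1 * v \<le> d ^ t * u" using tu(3) v by simp
          also have "\<dots> \<le> (b ^ t * u) ^ d" using bd tu(1) by (intro power_le_power_power) auto
          also have "\<dots> \<le> (?X ^ d ^ j i) ^ d" using tu(2) by (intro power_mono) auto
          also have "\<dots> = ?X ^ d ^ Suc (j i)" by (simp add: mult.commute flip: power_mult)
          finally show ?thesis .
        qed
        moreover have "2 ^ e (Suc i) \<le> 2 ^ 1 * W ^ Suc (j i)"
        proof -
          have "(2::nat) ^ t \<le> b ^ t" using bd by (intro power_mono) auto
          also have "\<dots> \<le> b ^ t * u" using tu(1) by simp
          also have "\<dots> \<le> W" using tu(2) W[of "j i"] jm[of i] Suc.prems by simp
          finally have "2 ^ e i \<le> W * W ^ j i" using tu(5) by (meson le_trans mult_le_mono1)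
          with True show ?thesis by (simp add: split_e)
        qed
        ultimately show ?thesis by - (rule exI[of _ 1], rule exI[of _ v], simp)
      qed
    qed
  qed
  from inv[OF i] obtain t u where tu: "0 < u" "b ^ t * u \<le> ?X ^ d ^ j i" "g (s + i) \<le> d ^ t * u"
     "2 ^ e i \<le> 2 ^ t * W ^ j i" by auto
  have j: "Suc (j i) \<le> m" using jm[OF i] by simp
  have "g (s + i) \<le> (b ^ t * u) ^ d" using power_le_power_power[OF bd(1) tu(1) bd(2), of t] tu(3) by linarith
  also have "\<dots> \<le> (?X ^ d ^ j i) ^ d" using tu(2) by (intro power_mono) auto
  also have "\<dots> = ?X ^ d ^ Suc (j i)" by (simp add: mult.commute flip: power_mult)
  also have "\<dots> \<le> W" by (rule W[OF j])
  finally show "g (s + i) \<le> W" .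
  have "(2::nat) ^ t \<le> b ^ t" using bd by (intro power_mono) auto
  also have "\<dots> \<le> b ^ t * u" using tu(1) by simp
  also have "\<dots> \<le> W" using tu(2) W[of "j i"] j by simp
  finally have "2 ^ e i \<le> W * W ^ j i" using tu(4) by (meson le_trans mult_le_mono1)
  also have "\<dots> = W ^ Suc (j i)" by simp
  also have "\<dots> \<le> W ^ m" using j W1 by (intro power_increasing) auto
  finally show "2 ^ card {t \<in> {s..<s + i}. E t} \<le> W ^ m" by (simp add: e_def)
qed

lemma abs_ln_diff_le:
  fixes x y :: real
  assumes "0 < \<delta>" "\<delta> \<le> x" "\<delta> \<le> y" "\<bar>x - y\<bar> \<le> 1"
  shows "\<bar>ln x - ln y\<bar> \<le> 1 / \<delta>"
proof -
  have *: "ln x - ln y \<le> 1 / \<delta>" if "0 < \<delta>" "\<delta> \<le> x" "\<delta> \<le> y" "\<bar>x - y\<bar> \<le> 1" for x y :: real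
  proof -
    have "ln x - ln y = ln (x / y)" using that by (simp add: ln_div)
    also have "\<dots> \<le> x / y - 1" using that by (intro ln_le_minus_one) auto
    also have "\<dots> = (x - y) / y" using that by (simp add: diff_divide_distrib)
    also have "\<dots> \<le> 1 / \<delta>" using that by (intro frac_le) auto
    finally show ?thesis .
  qed
  show ?thesis using *[of x y] *[of y x] assms by (simp add: abs_le_iff abs_minus_commute)
qed

text \<open>The increments of \<open>ln (g t)\<close> around the cycle sum to 0. An exact step
  contributes \<open>ln \<alpha>\<close>; any other step contributes \<open>ln \<rho>\<close> with
  an error of at most \<open>2 / X\<close>, because \<open>\<rho> \<ge> 1 / 2\<close> keeps both
  compared numbers at least \<open>X / 2\<close>.\<close>

lemma cycle_linear_form:
  fixes g :: "nat \<Rightarrow> nat" and E :: "nat \<Rightarrow> bool" and \<rho> \<alpha> :: real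
  assumes per: "g (s + p) = g s" and X: "0 < X" "\<And>i. X \<le> g i" and \<rho>: "1 / 2 \<le> \<rho>" and \<alpha>: "0 < \<alpha>"
    and E: "\<And>i. E i \<Longrightarrow> real (g (Suc i)) = \<alpha> * g i"
    and A: "\<And>i. \<not> E i \<Longrightarrow> \<bar>real (g (Suc i)) - \<rho> * g i\<bar> \<le> 1"
  defines "K \<equiv> card {t \<in> {s..<s + p}. E t}" and "L \<equiv> card {t \<in> {s..<s + p}. \<not> E t}"
  shows "\<bar>K * ln \<alpha> + L * ln \<rho>\<bar> \<le> 2 * L / X"
proof -
  let ?S = "{s..<s + p}"
  define \<delta> where "\<delta> = (\<lambda>t. ln (g (Suc t)) - ln (g t) - (if E t then ln \<alpha> else ln \<rho>))"
  have pos: "0 < real (g i)" for i using X(1) X(2)[of i] by linarith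
  have \<delta>: "\<bar>\<delta> t\<bar> \<le> (if E t then 0 else 2 / X)" for t
  proof (cases "E t")
    case True
    then show ?thesis using pos[of t] \<alpha> by (simp add: \<delta>_def E ln_mult)
  next
    case False
    have "real X / 2 \<le> \<rho> * g t"
      using \<rho> X(2)[of t] mult_mono[of "1 / 2" \<rho> "real X" "real (g t)"] by simp
    moreover have "real X / 2 \<le> g (Suc t)" using X(2)[of "Suc t"] by simp
    ultimately have "\<bar>ln (real (g (Suc t))) - ln (\<rho> * g t)\<bar> \<le> 1 / (real X / 2)"
      using X(1) A[OF False] by (intro abs_ln_diff_le) auto
    moreover have "ln (\<rho> * g t) = ln \<rho> + ln (g t)" using \<rho> pos[of t] by (simp add: ln_mult_pos)
    ultimately show ?thesis using False by (simp add: \<delta>_def algebra_simps)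
  qed
  have "(\<Sum>t\<in>?S. ln (g (Suc t)) - ln (g t)) = ln (g (s + p)) - ln (g s)"
    using sum_Suc_diff'[of s "s + p" "\<lambda>t. ln (real (g t))"] by simp
  then have "(\<Sum>t\<in>?S. (if E t then ln \<alpha> else ln \<rho>) + \<delta> t) = 0" by (simp add: \<delta>_def per)
  moreover have "(\<Sum>t\<in>?S. if E t then ln \<alpha> else ln \<rho>) = K * ln \<alpha> + L * ln \<rho>"
  proof -
    have "?S \<inter> {t. E t} = {t \<in> ?S. E t}" "?S \<inter> - {t. E t} = {t \<in> ?S. \<not> E t}" by auto
    then show ?thesis by (simp add: sum.If_cases K_def L_def)
  qed
  ultimately have "K * ln \<alpha> + L * ln \<rho> = - (\<Sum>t\<in>?S. \<delta> t)" by (simp add: sum.distrib)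
  then have "\<bar>K * ln \<alpha> + L * ln \<rho>\<bar> \<le> (\<Sum>t\<in>?S. \<bar>\<delta> t\<bar>)" by simp
  also have "\<dots> \<le> (\<Sum>t\<in>?S. if E t then 0 else 2 / X)" by (intro sum_mono \<delta>)
  also have "\<dots> = L * (2 / X)"
  proof -
    have "?S \<inter> - {t. E t} = {t \<in> ?S. \<not> E t}" by auto
    then show ?thesis by (simp add: sum.If_cases L_def)
  qed
  finally show ?thesis by (simp add: mult.commute)
qed

section \<open>A bound for the least element\<close>

lemma linear_le_exp:
  fixes n :: nat
  assumes "4000000 \<le> n" shows "2 * real n \<le> exp (n / 1000)"
proof -
  have "2 * real n \<le> (n / 1000)\<^sup>2 / 2"
  proof -
    have "4000000 * real n \<le> real n * real n"
      using of_nat_mono[OF assms, where 'a = real] by (intro mult_right_mono) auto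
    then show ?thesis by (simp add: power2_eq_square)
  qed
  also have "\<dots> \<le> exp (n / 1000)"
    using exp_lower_Taylor_quadratic[of "n / 1000"] by simp
  finally show ?thesis .
qed

text \<open>
  The size of \<open>n\<close> which makes \<open>U = n div 58\<close> admissible in
  \<open>two_logarithms_lower_bound\<close> when \<open>K\<close> and \<open>L\<close> are polynomial in \<open>n\<close>.
\<close>

lemma parameter_growth:
  fixes n d m :: nat
  assumes d: "2 \<le> d" and n: "10000000 * (m + 3) * d \<le> n"
  shows "10 * real (d ^ (m + 3)) * m * real n ^ 2 * real (n + 1) ^ 5 \<le> exp (n div 58)"
    and "2 * d + 3 \<le> n div 58"
proof -
  have md: "m + 3 \<le> (m + 3) * d" "d \<le> (m + 3) * d" using d by auto
  have n': "10000000 * ((m + 3) * d) \<le> n" using n by (simp only: mult.assoc)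
  have "3 * 2 \<le> (m + 3) * d" using d by (intro mult_mono) auto
  with n' have big: "60000000 \<le> n" by linarith
  then show "2 * d + 3 \<le> n div 58" using n' md by linarith
  have nr: "real ((m + 3) * d) \<le> n / 10000000"
    using of_nat_mono[OF n', where 'a = real] by simp
  have "real (d ^ (m + 3)) \<le> exp (n / 10000000)"
  proof -
    have "real d ^ (m + 3) \<le> exp d ^ (m + 3)"
      using exp_ge_add_one_self[of "real d"] by (intro power_mono) linarith+
    also have "\<dots> = exp (real ((m + 3) * d))" by (simp only: exp_of_nat_mult of_nat_mult)
    also have "\<dots> \<le> exp (n / 10000000)" using nr by simp
    finally show ?thesis by simp
  qed
  moreover have "real m \<le> exp (n / 10000000)"
  proof -
    have "real m \<le> real ((m + 3) * d)" using md by linarith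
    with nr show ?thesis using exp_ge_add_one_self[of "n / 10000000"] by linarith
  qed
  moreover have "10 \<le> exp (n / 1000)"
    using exp_ge_add_one_self[of "n / 1000"] big by linarith
  moreover have "real n ^ 2 \<le> exp (n / 1000) ^ 2" "real (n + 1) ^ 5 \<le> exp (n / 1000) ^ 5"
    using linear_le_exp[of n] big by (auto intro!: power_mono)
  ultimately have "10 * real (d ^ (m + 3)) * m * real n ^ 2 * real (n + 1) ^ 5
      \<le> exp (n / 1000) * exp (n / 10000000) * exp (n / 10000000) * exp (n / 1000) ^ 2 * exp (n / 1000) ^ 5"
    by (intro mult_mono) auto
  also have "\<dots> = exp (n / 1000 + n / 10000000 + n / 10000000 + 2 * (n / 1000) + 5 * (n / 1000))"
  proof -
    have "exp (n / 1000) ^ 2 = exp (2 * (n / 1000))" "exp (n / 1000) ^ 5 = exp (5 * (n / 1000))"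
      by (simp_all flip: exp_of_nat_mult)
    then show ?thesis by (simp only: exp_add)
  qed
  \<comment> \<open>The exponents add up to \<open>(8 / 1000 + 2 / 10000000) * n\<close>, about
    \<open>n / 125\<close>, which leaves room below \<open>n / 58\<close> for the rounding in
    \<open>n div 58\<close>.\<close>
  also have "\<dots> \<le> exp (n div 58)"
  proof -
    have "n < 58 * (n div 58) + 58" by linarith
    then have "real n \<le> 58 * real (n div 58) + 58" by linarith
    moreover have "60000000 \<le> real n" using of_nat_mono[OF big, where 'a = real] by simp
    ultimately show ?thesis by simp
  qed
  finally show "10 * real (d ^ (m + 3)) * m * real n ^ 2 * real (n + 1) ^ 5 \<le> exp (n div 58)" .
qed

text \<open>Cleared of denominators, a relation reads
  \<open>d ^ (x + y) * (b - 1) ^ y = b ^ (x + y) * (d - 1) ^ y\<close>. As \<open>d\<close> is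
  coprime to \<open>d - 1\<close>, it would force \<open>d ^ (x + y)\<close> to divide the smaller
  number \<open>b ^ (x + y)\<close>.\<close>

lemma ratios_independent:
  fixes b d x y :: nat
  assumes bd: "1 < b" "b < d" and xy: "0 < x" "0 < y"
  shows "(real d / real b) ^ x \<noteq> (real (b * (d - 1)) / real (d * (b - 1))) ^ y"
proof
  assume eq: "(real d / real b) ^ x = (real (b * (d - 1)) / real (d * (b - 1))) ^ y"
  have "real d ^ x * real (d * (b - 1)) ^ y = real (b * (d - 1)) ^ y * real b ^ x"
    using eq bd by (simp add: power_divide frac_eq_eq del: of_nat_mult)
  then have "real (d ^ x * (d * (b - 1)) ^ y) = real ((b * (d - 1)) ^ y * b ^ x)"
    by (simp only: of_nat_power of_nat_mult)
  then have "d ^ x * (d * (b - 1)) ^ y = (b * (d - 1)) ^ y * b ^ x" by (simp only: of_nat_eq_iff)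
  then have eq': "d ^ (x + y) * (b - 1) ^ y = b ^ (x + y) * (d - 1) ^ y"
    by (simp add: power_add power_mult_distrib mult_ac)
  have "coprime (d - 1) d" using bd by (intro coprime_diff_one_left_nat) auto
  then have "coprime (d ^ (x + y)) ((d - 1) ^ y)" by (simp add: coprime_commute)
  moreover have "d ^ (x + y) dvd b ^ (x + y) * (d - 1) ^ y" using eq' by (metis dvd_triv_left)
  ultimately have "d ^ (x + y) dvd b ^ (x + y)" by (simp add: coprime_dvd_mult_left_iff)
  then have "d ^ (x + y) \<le> b ^ (x + y)" using bd by (intro dvd_imp_le) auto
  then show False using bd xy power_strict_mono[of b d "x + y"] by simp
qed

text \<open>For \<open>X\<close> between \<open>2 ^ n ^ 5\<close> and \<open>2 ^ (n + 1) ^ 5\<close>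
  the form is at most \<open>exp n / exp (n ^ 5 / 2)\<close>, against the lower bound
  \<open>exp (- n ^ 4)\<close>; the fifth power is there to beat the fourth. Since \<open>K\<close>
  is then at most polynomial in \<open>n\<close>, taking \<open>U\<close> of size
  \<open>n / 58\<close> is admissible.\<close>

lemma cycle_minimum_bound:
  fixes b d m K L X :: nat
  defines "\<alpha> \<equiv> real d / real b" and "\<beta> \<equiv> real (b * (d - 1)) / real (d * (b - 1))"
  assumes bd: "1 < b" "b < d" and KL: "0 < K" "0 < L"
    and pw: "2 ^ K \<le> (X ^ d ^ m) ^ m" and form: "\<bar>K * ln \<alpha> - L * ln \<beta>\<bar> \<le> 2 * L / X"
  shows "X < 2 ^ (10000000 * (m + 3) * d) ^ 5"
proof (rule ccontr)
  define n0 where "n0 = 10000000 * (m + 3) * d"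
  assume "\<not> ?thesis"
  then have X: "2 ^ n0 ^ 5 \<le> X" by (simp add: n0_def)
  obtain n where n: "2 ^ n ^ 5 \<le> X" "X < 2 ^ (n + 1) ^ 5" "n0 \<le> n"
  proof -
    define P where "P = (\<lambda>n::nat. X < 2 ^ (n + 1) ^ 5)"
    have "X < 2 ^ X" by (rule less_exp)
    also have "\<dots> \<le> 2 ^ (X + 1) ^ 5"
      using self_le_power[of "X + 1" 5] by (intro power_increasing) auto
    finally have "P X" by (simp add: P_def)
    define n where "n = (LEAST n. P n)"
    have Pn: "P n" unfolding n_def using \<open>P X\<close> by (rule LeastI)
    have ge: "n0 \<le> n"
    proof (rule ccontr)
      assume "\<not> n0 \<le> n"
      then have "(2::nat) ^ (n + 1) ^ 5 \<le> 2 ^ n0 ^ 5" by (intro power_increasing power_mono) auto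
      with Pn X show False unfolding P_def by linarith
    qed
    moreover have "0 < n0" using bd by (simp add: n0_def)
    ultimately obtain k where k: "n = Suc k" by (cases n) auto
    then have "\<not> P k" using not_less_Least[of k P] by (simp add: n_def)
    then have "2 ^ n ^ 5 \<le> X" by (simp add: P_def k)
    with that Pn ge show thesis by (simp add: P_def)
  qed
  have d2: "2 \<le> d" using bd by simp
  define U where "U = n div 58"
  note growth = parameter_growth[OF d2 n(3)[unfolded n0_def], folded U_def]
  have d3: "2 * d + 3 \<le> n0"
  proof -
    have "3 * d \<le> (m + 3) * d" by (intro mult_right_mono) auto
    moreover have "n0 = 10000000 * ((m + 3) * d)" by (simp only: n0_def mult.assoc)
    ultimately show ?thesis using bd by linarith
  qed
  have m0: "0 < m"
  proof (rule ccontr)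
    assume "\<not> 0 < m"
    with pw have "(2::nat) ^ K \<le> 1" by simp
    moreover have "(2::nat) ^ 1 \<le> 2 ^ K" using KL by (intro power_increasing) auto
    ultimately show False by simp
  qed
  have rb: "2 \<le> real b" "real b + 1 \<le> real d" using bd by linarith+
  have r1: "real (b - 1) = real b - 1" "real (d - 1) = real d - 1" using bd by auto
  have \<alpha>1: "1 < \<alpha>" and \<alpha>d: "\<alpha> \<le> d" using bd by (simp_all add: \<alpha>_def divide_le_eq)
  have ln\<alpha>: "0 < ln \<alpha>" "ln \<alpha> \<le> d" using \<alpha>1 \<alpha>d ln_le_minus_one[of \<alpha>] by auto
  have \<beta>: "\<beta> = real b * (real d - 1) / (real d * (real b - 1))"
    unfolding \<beta>_def of_nat_mult r1 ..
  have den: "0 < real d * (real b - 1)" using rb by (intro mult_pos_pos) auto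
  have \<beta>2: "\<beta> \<le> 2"
  proof -
    have "2 * real d \<le> real b * real d" using rb by (intro mult_right_mono) auto
    then have "real b * (real d - 1) \<le> 2 * (real d * (real b - 1))"
      by (simp add: algebra_simps)
    then show ?thesis using den unfolding \<beta> by (simp add: pos_divide_le_eq)
  qed
  have \<beta>1: "1 + 1 / real d ^ 2 \<le> \<beta>"
  proof -
    have "\<beta> - 1 = (real d - real b) / (real d * (real b - 1))"
      unfolding \<beta> using den rb by (simp add: field_simps)
    moreover have "1 / real d ^ 2 \<le> (real d - real b) / (real d * (real b - 1))"
      unfolding power2_eq_square using rb by (intro frac_le mult_left_mono) auto
    ultimately show ?thesis by linarith
  qed
  then have \<beta>1': "1 < \<beta>" using bd zero_less_divide_1_iff[of "real d ^ 2"] by (intro less_le_trans[OF _ \<beta>1]) simp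
  have ln\<beta>: "1 / (2 * real d ^ 2) \<le> ln \<beta>" "ln \<beta> \<le> 1"
  proof -
    have "1 / (2 * real d ^ 2) = (1 / real d ^ 2) / 2" by simp
    also have "\<dots> \<le> (\<beta> - 1) / \<beta>" using \<beta>1 \<beta>1' \<beta>2 by (intro frac_le) auto
    also have "\<dots> = 1 - 1 / \<beta>" using \<beta>1' by (simp add: diff_divide_distrib)
    also have "\<dots> \<le> ln \<beta>" using ln_le_minus_one[of "1 / \<beta>"] \<beta>1' by (simp add: ln_div)
    finally show "1 / (2 * real d ^ 2) \<le> ln \<beta>" .
    show "ln \<beta> \<le> 1" using ln_le_minus_one[of \<beta>] \<beta>1' \<beta>2 by simp
  qed
  \<comment> \<open>For such \<open>X\<close> the error \<open>2 * L / X\<close> is at most half of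
    \<open>L / (2 * d ^ 2) \<le> L * ln \<beta>\<close>. The other half is then bounded by
    \<open>K * ln \<alpha>\<close>, which controls \<open>L\<close> in terms of
    \<open>K\<close>.\<close>
  have X8: "8 * d ^ 2 \<le> X"
  proof -
    have "d \<le> 2 ^ d" by (simp add: less_imp_le)
    then have "d ^ 2 \<le> (2 ^ d) ^ 2" by (rule power_mono) simp
    then have "8 * d ^ 2 \<le> 2 ^ (2 * d + 3)" by (simp add: power_add power_mult[symmetric] mult.commute)
    also have "\<dots> \<le> 2 ^ n0 ^ 5"
      using d3 self_le_power[of n0 5] by (intro power_increasing) auto
    also note X
    finally show ?thesis .
  qed
  have X0: "0 < X" using X8 bd by (intro gr0I) auto
  have X8r: "8 * real d ^ 2 \<le> real X" using of_nat_mono[OF X8, where 'a = real] by simp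
  have LK: "real L \<le> 4 * real d ^ 3 * K"
  proof -
    have "2 * real L / X \<le> 2 * real L / (8 * real d ^ 2)"
      using X8r X0 bd by (intro divide_left_mono mult_pos_pos) auto
    then have "2 * real L / X \<le> real L * (1 / (4 * real d ^ 2))" by simp
    moreover have "real L * (1 / (2 * real d ^ 2)) \<le> L * ln \<beta>" using ln\<beta> by (intro mult_left_mono) auto
    moreover have "K * ln \<alpha> \<le> K * real d" using ln\<alpha> by (intro mult_left_mono) auto
    moreover have "real L * (1 / (2 * real d ^ 2)) = 2 * (real L * (1 / (4 * real d ^ 2)))" by simp
    ultimately have "real L * (1 / (4 * real d ^ 2)) \<le> K * real d" using form by linarith
    then have "real L * (1 / (4 * real d ^ 2)) * (4 * real d ^ 2) \<le> K * real d * (4 * real d ^ 2)"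
      by (rule mult_right_mono) simp
    then show ?thesis using bd by (simp add: eval_nat_numeral mult_ac)
  qed
  have K: "K \<le> m * d ^ m * (n + 1) ^ 5"
  proof -
    have "2 ^ K \<le> (X ^ d ^ m) ^ m" by (rule pw)
    also have "\<dots> \<le> ((2 ^ (n + 1) ^ 5) ^ d ^ m) ^ m" using n(2) by (intro power_mono) auto
    also have "\<dots> = 2 ^ (m * d ^ m * (n + 1) ^ 5)" by (simp add: mult_ac flip: power_mult)
    finally show ?thesis by (rule power_le_imp_le_exp[rotated]) simp
  qed
  have d1: "1 \<le> real d ^ 3" using bd by simp
  have KL5: "real (K + L) \<le> 5 * real (d ^ (m + 3)) * m * real (n + 1) ^ 5"
  proof -
    have "real K \<le> real d ^ 3 * K" using d1 mult_right_mono[of 1 "real d ^ 3" "real K"] by simp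
    then have "real (K + L) \<le> 5 * real d ^ 3 * K" using LK by simp
    also have "\<dots> \<le> 5 * real d ^ 3 * real (m * d ^ m * (n + 1) ^ 5)"
      using K by (intro mult_left_mono of_nat_mono) auto
    also have "\<dots> = 5 * real (d ^ (m + 3)) * m * real (n + 1) ^ 5"
      by (simp add: power_add mult_ac)
    finally show ?thesis .
  qed
  have n1: "1 \<le> real n" using n(3) d3 by linarith
  have Ueq: "exp (real U) \<ge> 2 * real n ^ 2 * (K + L)"
  proof -
    have "2 * real n ^ 2 * real (K + L) \<le> 2 * real n ^ 2 * (5 * real (d ^ (m + 3)) * m * real (n + 1) ^ 5)"
      using KL5 by (intro mult_left_mono) auto
    also have "\<dots> = 10 * real (d ^ (m + 3)) * m * real n ^ 2 * real (n + 1) ^ 5" by (simp add: mult_ac)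
    also note growth(1)
    finally show ?thesis by simp
  qed
  have "exp (- (real n ^ 4)) < \<bar>K * ln \<alpha> - L * ln \<beta>\<bar>"
    unfolding \<alpha>_def \<beta>_def
  proof (rule two_logarithms_lower_bound[where Q = "d * d" and U = U])
    show "0 < b" "b < d" "d \<le> d * d" "0 < d * (b - 1)" using bd by auto
    show "b * (d - 1) \<le> d * d" using bd by (intro mult_mono) auto
    have "real (d * (b - 1)) < real (b * (d - 1))" using bd unfolding of_nat_mult r1 by (simp add: algebra_simps)
    then show "d * (b - 1) < b * (d - 1)" by (simp only: of_nat_less_iff)
    show "ln (real d / real b) + ln (real (b * (d - 1)) / real (d * (b - 1))) + 1 \<le> real U"
      using ln\<alpha>(2) ln\<beta>(2) growth(2) unfolding \<alpha>_def \<beta>_def by linarith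
    have "ln (real (d * d)) = 2 * ln (real d)" using bd by (simp add: ln_mult)
    also have "\<dots> \<le> 2 * real d" using bd ln_le_minus_one[of "real d"] by simp
    also have "\<dots> \<le> real U" using growth(2) by linarith
    finally show "ln (real (d * d)) \<le> real U" .
    show "ln (2 * (real n)\<^sup>2 * real (K + L)) \<le> real U"
    proof -
      have "0 < 2 * (real n)\<^sup>2 * real (K + L)" using n1 KL by simp
      then have "ln (2 * (real n)\<^sup>2 * real (K + L)) \<le> ln (exp (real U))"
        using Ueq by (subst ln_le_cancel_iff) auto
      then show ?thesis by simp
    qed
    show "58 * U \<le> n" by (simp add: U_def)
  qed (use ratios_independent[OF bd] KL in auto)
  also have "\<dots> \<le> 2 * L / X" by (rule form)
  also have "\<dots> \<le> exp n / exp (real n ^ 5 / 2)"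
  proof (rule frac_le)
    have "2 * real L \<le> 2 * real n ^ 2 * (K + L)"
      using n1 mult_right_mono[of 1 "real n ^ 2" "real (K + L)"] by simp
    also have "\<dots> \<le> exp U" by (rule Ueq)
    also have "\<dots> \<le> exp n" by (simp add: U_def)
    finally show "real (2 * L) \<le> exp n" by simp
    have "exp (1 / 2 :: real) ^ 2 \<le> 2 ^ 2" using exp_le by (simp flip: exp_of_nat_mult)
    then have "exp (1 / 2 :: real) \<le> 2" by (rule power2_le_imp_le) simp
    then have "exp (1 / 2 :: real) ^ n ^ 5 \<le> 2 ^ n ^ 5" by (intro power_mono) auto
    also have "\<dots> \<le> real X" using of_nat_mono[OF n(1), where 'a = real] by simp
    finally show "exp (real n ^ 5 / 2) \<le> real X" by (simp flip: exp_of_nat_mult)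
  qed auto
  finally have "- (real n ^ 4) < n - real n ^ 5 / 2" by (simp flip: exp_diff)
  moreover have "real n \<le> real n ^ 4" using n1 by (simp add: self_le_power)
  moreover have "4 * real n ^ 4 \<le> real n ^ 5"
  proof -
    have "4 \<le> real n" using n(3) d3 bd by linarith
    then have "4 * real n ^ 4 \<le> real n * real n ^ 4" by (intro mult_right_mono) auto
    then show ?thesis by (simp add: eval_nat_numeral)
  qed
  ultimately show False by linarith
qed

section \<open>Enumeration of the cycles\<close>

text \<open>The first factor of the exponent bounds the least element, and
  \<open>(b + d) ^ m\<close> is the growth along \<open>m\<close> runs. Using \<open>b + d\<close>
  in place of the larger of \<open>b\<close> and \<open>d\<close> makes the bound symmetric, hence
  common to the map and its inverse.\<close>

definition cycle_bound :: "nat \<Rightarrow> nat \<Rightarrow> nat \<Rightarrow> nat" where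
  "cycle_bound b d m = 2 ^ ((10000000 * (m + 3) * (b + d)) ^ 5 * (b + d) ^ m)"

lemma cycle_bound_commute: "cycle_bound b d m = cycle_bound d b m"
  by (simp add: cycle_bound_def add.commute)

lemma inj_on_mod_window: "inj_on (\<lambda>t. t mod p) {s..<s + p :: nat}"
proof -
  have *: "t = t'" if "t \<in> {s..<s + p}" "t' \<in> {s..<s + p}" "t mod p = t' mod p" "t \<le> t'" for t t'
  proof -
    have "p dvd t' - t" using that by (metis mod_eq_dvd_iff_nat)
    moreover have "t' - t < p" using that by auto
    ultimately have "t' - t = 0" by (metis dvd_imp_le gr0I not_less)
    with that show ?thesis by simp
  qed
  show ?thesis
    by (rule inj_onI) (metis * nle_le)
qed

lemma image_mod_window:
  assumes "0 < p" shows "(\<lambda>t. t mod p) ` {s..<s + p :: nat} = {..<p}"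
  using assms by (intro card_subset_eq) (auto simp: card_image inj_on_mod_window)

text \<open>The cycle is unrolled to a periodic sequence \<open>g\<close> and read over one period
  from its least element. Exact steps rise and the others fall, so every run starts at a local
  minimum and there are at most \<open>m\<close> of them.\<close>

lemma ascending_cycle_bound:
  assumes b: "1 < b" "b < d" and m: "0 < m"
    and xs: "xs \<in> m_cycles (collapsed_map b d) m" and x: "x \<in> set xs"
  shows "x \<le> cycle_bound b d m"
proof -
  define f where "f = collapsed_map b d"
  define p where "p = length xs"
  define g where "g = (\<lambda>i. xs ! (i mod p))"
  define E where "E = (\<lambda>i. b dvd g i)"
  have cyc: "is_cycle f xs" and mins: "card (local_minima xs) = m"
    using xs by (auto simp: m_cycles_def f_def)
  have p: "0 < p" using cyc by (auto simp: is_cycle_def p_def)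
  have step: "f (g i) = g (Suc i)" for i
    using cyc p mod_less_divisor[OF p, of i] by (simp add: is_cycle_def g_def p_def mod_Suc_eq)
  have per: "g (i + p * k) = g i" for i k by (simp add: g_def)
  \<comment> \<open>A fixed point would make all of \<open>xs\<close> constant and leave no local
    minimum, contrary to \<open>m > 0\<close>. This excludes 0 and makes the non-exact steps
    strictly decreasing.\<close>
  have not_fixed: "g (Suc i) \<noteq> g i" for i
  proof
    assume eq: "g (Suc i) = g i"
    have const: "g (i + k) = g i" for k
    proof (induction k)
      case (Suc k)
      have "g (i + Suc k) = f (g (i + k))" by (simp add: step)
      also have "\<dots> = g (Suc i)" unfolding Suc by (rule step)
      finally show ?case by (simp only: eq)
    qed simp
    have "g j = g i" for j
    proof -
      have "i \<le> j + p * i" using p by (simp add: trans_le_add2)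
      then show ?thesis using const[of "j + p * i - i"] per[of j i] by simp
    qed
    then have "xs ! j = g i" if "j < p" for j
      using that by (metis g_def mod_less)
    then have "local_minima xs = {}"
      using p by (auto simp: local_minima_def p_def)
    with mins m show False by simp
  qed
  have fE: "f (g i) = d * (g i div b)" if "E i" for i
    using that by (simp add: f_def collapsed_map_def E_def dvd_eq_mod_eq_0)
  have pos: "0 < g i" for i
  proof (rule gr0I)
    assume 0: "g i = 0"
    then have "E i" by (simp add: E_def)
    then have "g (Suc i) = 0" using fE[of i] step[of i] 0 by simp
    with 0 not_fixed[of i] show False by simp
  qed
  have Astep: "g (Suc i) \<le> g i"
     "\<bar>real (g (Suc i)) - real (d * (b - 1)) / real (b * (d - 1)) * g i\<bar> \<le> 1" if "\<not> E i" for i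
  proof -
    have eq: "collapsed_map b d (g i) = g (Suc i)" using step[of i] by (simp only: f_def)
    have "\<not> b dvd g i" using that by (simp only: E_def not_False_eq_True)
    note * = collapsed_map_nonmultiple[OF b(1) less_imp_le[OF b(2)] this, unfolded eq]
    show "g (Suc i) \<le> g i" by (rule *(1))
    show "\<bar>real (g (Suc i)) - real (d * (b - 1)) / real (b * (d - 1)) * g i\<bar> \<le> 1" by (rule *(2))
  qed
  have Alt: "g (Suc i) < g i" if "\<not> E i" for i
    using Astep(1)[OF that] not_fixed[of i] by simp
  \<comment> \<open>Cancelling the common divisor gives the coprime pair that
    \<open>runs_growth\<close> requires, with the same ratio \<open>d / b\<close>.\<close>
  define h where "h = gcd b d"
  define b' where "b' = b div h"
  define d' where "d' = d div h"
  have h: "0 < h" "b = b' * h" "d = d' * h" using b by (auto simp: h_def b'_def d'_def)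
  have cop: "coprime b' d'" unfolding b'_def d'_def h_def using b by (intro div_gcd_coprime) auto
  have bd': "0 < b'" "b' < d'"
  proof -
    show "0 < b'" using b h(2) by (intro gr0I) auto
    show "b' < d'" using b(2) h by simp
  qed
  have d'd: "d' \<le> d" using h by simp
  have Estep: "b' * g (Suc i) = d' * g i" if "E i" for i
  proof -
    obtain u where u: "g i = b * u" using \<open>E i\<close> unfolding E_def by (rule dvdE)
    have "g (Suc i) = d * (g i div b)" using fE[OF that] step[of i] by simp
    then have "g (Suc i) = d * u" using u b by simp
    then show ?thesis unfolding u by (simp add: h(2,3) mult_ac)
  qed
  have Egt: "g i < g (Suc i)" if "E i" for i
  proof -
    have "b' * g i < d' * g i" using bd' pos by simp
    also have "\<dots> = b' * g (Suc i)" using Estep[OF that] by simp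
    finally show ?thesis by simp
  qed
  obtain s where s: "0 < s" "\<And>i. g s \<le> g i"
  proof -
    have "Min (g ` {..<p}) \<in> g ` {..<p}" using p by (intro Min_in) auto
    then obtain s where s: "s < p" "g s = Min (g ` {..<p})" by auto
    have "g s \<le> g i" for i
    proof -
      have "g s \<le> g (i mod p)" unfolding s(2) using p by (intro Min_le) auto
      then show ?thesis by (simp add: g_def)
    qed
    moreover have "g (s + p) = g s" using per[of s 1] by simp
    ultimately show thesis using that[of "s + p"] p by simp
  qed
  have Es: "E s" using Alt[of s] s(2)[of "Suc s"] by linarith
  have Eprev: "\<not> E (s - 1)" using Egt[of "s - 1"] s by (metis Suc_diff_1 leD)
  have Elast: "\<not> E (s + (p - 1))"
  proof -
    have "g (s + (p - 1)) = g (s - 1)" using per[of "s - 1" 1] s p by simp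
    with Eprev show ?thesis by (simp add: E_def)
  qed
  \<comment> \<open>If \<open>b'\<close> were 1, \<open>b\<close> would divide \<open>d\<close>, and
    every image of a multiple of \<open>b\<close> would again be a multiple of \<open>b\<close>: the
    run starting at \<open>s\<close> would never end.\<close>
  have b'2: "2 \<le> b'"
  proof (rule ccontr)
    assume "\<not> 2 \<le> b'"
    then have "b' = 1" using bd' by simp
    then have "b dvd d" using h by simp
    then have "E (Suc i)" if "E i" for i
      using fE[OF that] by (simp add: step E_def)
    then have "E (s + k)" for k by (induction k) (use Es in auto)
    with Elast show False by blast
  qed
  \<comment> \<open>The run starting at \<open>s\<close> is split off; the runs starting later in
    the period therefore number fewer than \<open>m\<close>.\<close>
  have window: "{t \<in> {s..<s + p}. \<not> E (t - 1) \<and> E t} = insert s {t \<in> {s<..<s + p}. \<not> E (t - 1) \<and> E t}"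
    using Es Eprev p by auto
  have "card {t \<in> {s..<s + p}. \<not> E (t - 1) \<and> E t} \<le> card (local_minima xs)"
  proof (rule card_inj_on_le)
    show "inj_on (\<lambda>t. t mod p) {t \<in> {s..<s + p}. \<not> E (t - 1) \<and> E t}"
      by (rule inj_on_subset[OF inj_on_mod_window[of p s]]) auto
    show "finite (local_minima xs)" by (simp add: local_minima_def)
    show "(\<lambda>t. t mod p) ` {t \<in> {s..<s + p}. \<not> E (t - 1) \<and> E t} \<subseteq> local_minima xs"
    proof (rule image_subsetI)
      fix t assume "t \<in> {t \<in> {s..<s + p}. \<not> E (t - 1) \<and> E t}"
      then have t: "0 < t" "\<not> E (t - 1)" "E t" using s(1) by auto
      have "(t mod p + p - 1) mod p = (t mod p + (p - 1)) mod p" using p by simp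
      also have "\<dots> = (t + (p - 1)) mod p" by (rule mod_add_left_eq)
      also have "t + (p - 1) = t - 1 + p" using t(1) p by simp
      finally have prev: "(t mod p + p - 1) mod p = (t - 1) mod p" by simp
      have nxt: "(t mod p + 1) mod p = Suc t mod p" by (simp add: mod_Suc_eq)
      have "g t < g (t - 1)" using Alt[OF t(2)] t(1) by simp
      moreover have "g t < g (Suc t)" using Egt[OF t(3)] .
      ultimately show "t mod p \<in> local_minima xs"
        using p prev nxt by (simp add: local_minima_def p_def[symmetric] g_def)
    qed
  qed
  then have count: "card {t \<in> {s<..<s + p}. \<not> E (t - 1) \<and> E t} < m"
    unfolding window mins by simp
  have d'0: "0 < d'" using bd' by simp
  note growth = runs_growth[where g = g and E = E, OF b'2 d'0 cop Estep Astep(1) pos count]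
  define K where "K = card {t \<in> {s..<s + p}. E t}"
  define L where "L = card {t \<in> {s..<s + p}. \<not> E t}"
  have X1: "1 \<le> g s" using pos[of s] by simp
  have le: "g s ^ d' ^ m \<le> g s ^ d ^ m"
    using X1 d'd by (intro power_increasing power_mono) auto
  have "2 ^ K \<le> (g s ^ d' ^ m) ^ m"
  proof -
    \<comment> \<open>The step from the last position of the period back to the minimum is not
      exact, so no exact step is lost by stopping at \<open>p - 1 < p\<close>.\<close>
    have "{t \<in> {s..<s + p}. E t} = {t \<in> {s..<s + (p - 1)}. E t}"
    proof (intro equalityI subsetI)
      fix t assume t: "t \<in> {t \<in> {s..<s + p}. E t}"
      then have "t \<noteq> s + (p - 1)" using Elast by blast
      with t show "t \<in> {t \<in> {s..<s + (p - 1)}. E t}" by auto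
    qed auto
    then show ?thesis unfolding K_def using growth(2)[of "p - 1"] p by simp
  qed
  also have "\<dots> \<le> (g s ^ d ^ m) ^ m" using le by (rule power_mono) simp
  finally have pw: "2 ^ K \<le> (g s ^ d ^ m) ^ m" .
  have "g s < 2 ^ (10000000 * (m + 3) * d) ^ 5"
  proof (rule cycle_minimum_bound[OF b _ _ pw])
    have fin: "finite {t \<in> {s..<s + p}. Q t}" for Q by simp
    have "s \<in> {t \<in> {s..<s + p}. E t}" using Es p by auto
    then show "0 < K" unfolding K_def card_gt_0_iff using fin[of E] by blast
    have "s + (p - 1) \<in> {t \<in> {s..<s + p}. \<not> E t}" using Elast p by auto
    then show "0 < L" unfolding L_def card_gt_0_iff using fin[of "\<lambda>t. \<not> E t"] by blast
    let ?\<rho> = "real (d * (b - 1)) / real (b * (d - 1))"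
    have r: "0 < real (b * (d - 1))" "0 < real (d * (b - 1))" using b by auto
    have "\<bar>K * ln (real d / real b) + L * ln ?\<rho>\<bar> \<le> 2 * real L / real (g s)"
      unfolding K_def L_def
    proof (rule cycle_linear_form)
      show "g (s + p) = g s" using per[of s 1] by simp
      have "real b * (real d - 1) \<le> 2 * (real d * (real b - 1))"
      proof -
        have "2 * real d \<le> real b * real d" using b by (intro mult_right_mono) auto
        then show ?thesis by (simp add: algebra_simps)
      qed
      moreover have "real (b * (d - 1)) = real b * (real d - 1)" "real (d * (b - 1)) = real d * (real b - 1)"
        using b by auto
      ultimately show "1 / 2 \<le> ?\<rho>" using r(1) by (simp add: pos_le_divide_eq del: of_nat_mult)
      show "0 < real d / real b" using b by simp
      show "real (g (Suc i)) = real d / real b * real (g i)" if "E i" for i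
      proof -
        have "b * g (Suc i) = d * g i"
          using Estep[OF that] by (simp add: h(2,3) mult_ac)
        then have "real b * real (g (Suc i)) = real d * real (g i)" by (metis of_nat_mult)
        then show ?thesis using b by (simp add: field_simps)
      qed
    qed (use X1 s(2) Astep(2) in auto)
    moreover have "ln (real (b * (d - 1)) / real (d * (b - 1))) = - ln ?\<rho>"
      using r by (simp add: ln_div del: of_nat_mult)
    ultimately show "\<bar>K * ln (real d / real b) - L * ln (real (b * (d - 1)) / real (d * (b - 1)))\<bar> \<le> 2 * L / g s"
      by simp
  qed
  also have "\<dots> \<le> 2 ^ (10000000 * (m + 3) * (b + d)) ^ 5"
    by (intro power_increasing power_mono mult_left_mono) auto
  finally have gs: "g s \<le> 2 ^ (10000000 * (m + 3) * (b + d)) ^ 5" by simp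
  obtain i where i: "i < p" "x = g i"
    using x by (auto simp: in_set_conv_nth p_def g_def)
  then obtain t where t: "t \<in> {s..<s + p}" "t mod p = i"
    using image_mod_window[OF p, of s] by (metis imageE lessThan_iff)
  then have "x = g (s + (t - s))" "t - s < p" using i by (auto simp: g_def)
  then have "x \<le> g s ^ d' ^ m" using growth(1)[of "t - s"] by simp
  also note le
  also have "g s ^ d ^ m \<le> g s ^ (b + d) ^ m" using X1 by (intro power_increasing power_mono) auto
  also have "\<dots> \<le> (2 ^ (10000000 * (m + 3) * (b + d)) ^ 5) ^ (b + d) ^ m" using gs by (rule power_mono) simp
  also have "\<dots> = cycle_bound b d m" by (simp only: cycle_bound_def power_mult)
  finally show ?thesis .
qed

section \<open>Reversed cycles and the inverse map\<close>

lemma nth_rev_cyclic: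
  assumes "i < length xs"
  shows "rev xs ! ((i + 1) mod length xs) = xs ! ((length xs - 1 - i + length xs - 1) mod length xs)"
    and "rev xs ! ((i + length xs - 1) mod length xs) = xs ! ((length xs - 1 - i + 1) mod length xs)"
proof -
  define p where "p = length xs"
  have p: "i < p" using assms by (simp add: p_def)
  have rn: "rev xs ! j = xs ! (p - 1 - j)" if "j < p" for j
    using that by (simp add: rev_nth p_def)
  show "rev xs ! ((i + 1) mod length xs) = xs ! ((length xs - 1 - i + length xs - 1) mod length xs)"
    unfolding p_def[symmetric]
  proof (cases "i + 1 = p")
    case True
    then have "(p - 1 - i + p - 1) mod p = p - 1" "(i + 1) mod p = 0" by auto
    then show "rev xs ! ((i + 1) mod p) = xs ! ((p - 1 - i + p - 1) mod p)"
      using rn[of 0] p by (simp only:; simp)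
  next
    case False
    then have "p - 1 - i + p - 1 = p - 1 - (i + 1) + p" using p by linarith
    then have "(p - 1 - i + p - 1) mod p = (p - 1 - (i + 1) + p) mod p" by (rule arg_cong)
    also have "\<dots> = p - 1 - (i + 1)" unfolding mod_add_self2 using p by simp
    finally have "(p - 1 - i + p - 1) mod p = p - 1 - (i + 1)" .
    moreover have "(i + 1) mod p = i + 1" using p False by simp
    ultimately show "rev xs ! ((i + 1) mod p) = xs ! ((p - 1 - i + p - 1) mod p)"
      using rn[of "i + 1"] p False by (simp only:; simp)
  qed
  show "rev xs ! ((i + length xs - 1) mod length xs) = xs ! ((length xs - 1 - i + 1) mod length xs)"
    unfolding p_def[symmetric]
  proof (cases "i = 0")
    case True
    then have "(i + p - 1) mod p = p - 1" "(p - 1 - i + 1) mod p = 0" using p by auto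
    then show "rev xs ! ((i + p - 1) mod p) = xs ! ((p - 1 - i + 1) mod p)"
      using rn[of "p - 1"] p by (simp only:; simp)
  next
    case False
    then have "i + p - 1 = i - 1 + p" by simp
    then have "(i + p - 1) mod p = (i - 1 + p) mod p" by (rule arg_cong)
    also have "\<dots> = i - 1" unfolding mod_add_self2 using p by simp
    finally have "(i + p - 1) mod p = i - 1" .
    moreover have "(p - 1 - i + 1) mod p = p - 1 - (i - 1)"
    proof -
      have "p - 1 - i + 1 = p - 1 - (i - 1)" "p - 1 - (i - 1) < p" using p False by linarith+
      then show ?thesis by simp
    qed
    ultimately show "rev xs ! ((i + p - 1) mod p) = xs ! ((p - 1 - i + 1) mod p)"
      using rn[of "i - 1"] p by (simp only:; simp)
  qed
qed

lemma reflect_image: "i < p \<and> P (p - 1 - i) \<longleftrightarrow> i \<in> (\<lambda>i. p - 1 - i) ` {i. i < p \<and> P i}" for p i :: nat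
proof
  assume "i < p \<and> P (p - 1 - i)"
  then show "i \<in> (\<lambda>i. p - 1 - i) ` {i. i < p \<and> P i}"
    by (intro image_eqI[of _ _ "p - 1 - i"]) auto
qed auto

lemma card_reflect: "card {i. i < p \<and> P (p - 1 - i)} = card {i. i < p \<and> P i}" for p :: nat
proof -
  have "{i. i < p \<and> P (p - 1 - i)} = (\<lambda>i. p - 1 - i) ` {i. i < p \<and> P i}"
    using reflect_image[of _ p P] by blast
  moreover have "inj_on (\<lambda>i. p - 1 - i) {i. i < p \<and> P i}"
    by (auto simp: inj_on_def)
  ultimately show ?thesis by (simp add: card_image)
qed

text \<open>Reversal exchanges the two neighbours of an element, and the definitions of local
  minimum and maximum are symmetric in them.\<close>

lemma rev_m_cycle:
  assumes xs: "xs \<in> m_cycles f m" and inv: "\<And>x. f' (f x) = x"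
  shows "rev xs \<in> m_cycles f' m"
proof -
  define p where "p = length xs"
  have cyc: "xs \<noteq> []" "distinct xs" "\<And>i. i < p \<Longrightarrow> f (xs ! i) = xs ! ((i + 1) mod p)"
    and mins: "card (local_minima xs) = m" "card (local_maxima xs) = m"
    using xs by (auto simp: m_cycles_def is_cycle_def p_def)
  have p: "0 < p" using cyc(1) by (simp add: p_def)
  note rv = nth_rev_cyclic[of _ xs, folded p_def]
  have rn: "rev xs ! i = xs ! (p - 1 - i)" if "i < p" for i
    using that by (simp add: rev_nth p_def)
  have "f' (rev xs ! i) = rev xs ! ((i + 1) mod p)" if i: "i < p" for i
  proof -
    define k where "k = (p - 1 - i + p - 1) mod p"
    have "(k + 1) mod p = (p - 1 - i + p - 1 + 1) mod p" unfolding k_def by (rule mod_add_left_eq)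
    also have "p - 1 - i + p - 1 + 1 = p - 1 - i + p" using p by simp
    also have "\<dots> mod p = p - 1 - i" unfolding mod_add_self2 using i by simp
    finally have "(k + 1) mod p = p - 1 - i" .
    moreover have "k < p" using p by (simp add: k_def)
    ultimately have "f (xs ! k) = xs ! (p - 1 - i)" using cyc(3)[of k] by simp
    then show ?thesis using inv[of "xs ! k"] rv(1)[OF i] rn[OF i] by (simp add: k_def)
  qed
  then have "is_cycle f' (rev xs)" using cyc by (simp add: is_cycle_def p_def)
  moreover have "card (local_minima (rev xs)) = m"
  proof -
    have "local_minima (rev xs) = {i. i < p \<and> (\<lambda>i. xs ! ((i + p - 1) mod p) > xs ! i \<and> xs ! i < xs ! ((i + 1) mod p)) (p - 1 - i)}"
      unfolding local_minima_def length_rev p_def[symmetric] using rv rn by auto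
    then show ?thesis using mins(1) card_reflect[of p "\<lambda>i. xs ! ((i + p - 1) mod p) > xs ! i \<and> xs ! i < xs ! ((i + 1) mod p)"]
      by (simp add: local_minima_def p_def)
  qed
  moreover have "card (local_maxima (rev xs)) = m"
  proof -
    have "local_maxima (rev xs) = {i. i < p \<and> (\<lambda>i. xs ! ((i + p - 1) mod p) < xs ! i \<and> xs ! i > xs ! ((i + 1) mod p)) (p - 1 - i)}"
      unfolding local_maxima_def length_rev p_def[symmetric] using rv rn by auto
    then show ?thesis using mins(2) card_reflect[of p "\<lambda>i. xs ! ((i + p - 1) mod p) < xs ! i \<and> xs ! i > xs ! ((i + 1) mod p)"]
      by (simp add: local_maxima_def p_def)
  qed
  ultimately show ?thesis by (simp add: m_cycles_def)
qed

text \<open>For \<open>d < b\<close> the reverse of a cycle is a cycle of the inverse map, where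
  \<open>b\<close> and \<open>d\<close> are exchanged. For \<open>b = d\<close> the map is the
  identity, whose cycles have no local minimum.\<close>

lemma m_cycle_bound:
  assumes params: "0 < a" "1 < b" "0 < c" "1 < d" "a * (b - 1) = c * (d - 1)" and m: "0 < m"
    and xs: "xs \<in> m_cycles (P_map a b c d) m" and x: "x \<in> set xs"
  shows "x \<le> cycle_bound b d m"
proof -
  note P = P_map_eq_collapsed_map[OF params]
  consider "b < d" | "d < b" | "b = d" by linarith
  then show ?thesis
  proof cases
    case 1
    then show ?thesis using ascending_cycle_bound[of b d m xs x] params m xs x by (simp add: P)
  next
    case 2
    have P': "P_map c d a b = collapsed_map d b" using params by (intro P_map_eq_collapsed_map) auto
    have "rev xs \<in> m_cycles (P_map c d a b) m"
      using xs by (rule rev_m_cycle) (use params in \<open>auto intro!: P_map_inverse\<close>)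
    then show ?thesis
      using ascending_cycle_bound[of d b m "rev xs" x] 2 params m x
      by (simp add: P' cycle_bound_commute[of b d])
  next
    case 3
    have id: "collapsed_map b d y = y" for y
    proof (cases "b dvd y")
      case True
      then show ?thesis by (simp add: collapsed_map_def 3[symmetric])
    next
      case False
      then have *: "collapsed_map b d y = Suc (y - 1 - y div b + (y - 1 - y div b) div (b - 1))"
        by (simp add: collapsed_map_def dvd_eq_mod_eq_0 3[symmetric])
      show ?thesis by (rule trans[OF * sym[OF Suc_index_div[OF params(2) False]]])
    qed
    have "xs ! ((i + 1) mod length xs) = xs ! i" if "i < length xs" for i
    proof -
      have "collapsed_map b d (xs ! i) = xs ! ((i + 1) mod length xs)"
        using xs that unfolding P m_cycles_def is_cycle_def by blast
      then show ?thesis by (simp only: id)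
    qed
    then have "local_minima xs = {}" by (auto simp: local_minima_def)
    then show ?thesis using xs m by (simp add: m_cycles_def)
  qed
qed

text \<open>All elements lie below \<open>B\<close> and are distinct, so the length is at most
  \<open>B\<close> as well; the codes \<open>p * B + y\<close> with \<open>p \<le> B\<close> and
  \<open>y < B\<close> are exactly those below \<open>Suc B * B\<close>.\<close>

lemma set_bounded_m_cycles_eq:
  assumes params: "0 < a" "1 < b" "0 < c" "1 < d" "a * (b - 1) = c * (d - 1)" and m: "0 < m"
  defines "B \<equiv> Suc (cycle_bound b d m)"
  shows "set (bounded_m_cycles b d m B (Suc B * B)) = m_cycles (P_map a b c d) m"
proof -
  let ?f = "collapsed_map b d"
  note P = P_map_eq_collapsed_map[OF params]
  show ?thesis
  proof (intro equalityI subsetI)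
    fix xs assume "xs \<in> set (bounded_m_cycles b d m B (Suc B * B))"
    then show "xs \<in> m_cycles (P_map a b c d) m"
      unfolding P m_cycles_eq_orbits set_bounded_m_cycles by blast
  next
    fix xs assume xs: "xs \<in> m_cycles (P_map a b c d) m"
    then obtain p y where py: "xs = orbit ?f p y" "is_m_orbit ?f m p y"
      unfolding P m_cycles_eq_orbits by blast
    then have p: "0 < p" by (simp add: is_m_orbit_def)
    have sub: "set xs \<subseteq> {..<B}"
      using m_cycle_bound[OF params m xs] by (auto simp: B_def less_Suc_eq_le)
    have "distinct xs" using xs by (simp add: m_cycles_def is_cycle_def)
    then have "card (set xs) = length xs" by (rule distinct_card)
    then have "p = card (set xs)" by (simp add: py(1) orbit_def)
    also have "\<dots> \<le> B" using card_mono[OF _ sub] by simp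
    finally have pB: "p \<le> B" .
    have "y \<in> set xs" using p by (force simp: py(1) orbit_def)
    then have y: "y < B" using sub by auto
    define i where "i = p * B + y"
    have i: "i div B = p" "i mod B = y" using y by (simp_all add: i_def)
    have "p * B \<le> B * B" using pB by (rule mult_right_mono) simp
    moreover have "Suc B * B = B + B * B" by simp
    ultimately have "i < Suc B * B" using y unfolding i_def by linarith
    with i py show "xs \<in> set (bounded_m_cycles b d m B (Suc B * B))"
      unfolding set_bounded_m_cycles by blast
  qed
qed

theorem mainTheorem1:
  "(\<forall>a b c d m :: nat.
      0 < a \<and> 1 < b \<and> 0 < c \<and> 1 < d \<and> a * (b - 1) = c * (d - 1) \<and> 0 < m \<longrightarrow>
        finite (m_cycles (P_map a b c d) m)) \<and>
   (\<exists>algorithm :: recf. \<forall>a b c d m :: nat.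
      0 < a \<and> 1 < b \<and> 0 < c \<and> 1 < d \<and> a * (b - 1) = c * (d - 1) \<and> 0 < m \<longrightarrow>
        (\<exists>L :: nat list list.
          rec_eval algorithm [a, b, c, d, m] (list_encode (map list_encode L)) \<and>
          set L = m_cycles (P_map a b c d) m))"
proof (intro conjI allI impI)
  fix a b c d m :: nat
  assume "0 < a \<and> 1 < b \<and> 0 < c \<and> 1 < d \<and> a * (b - 1) = c * (d - 1) \<and> 0 < m"
  then show "finite (m_cycles (P_map a b c d) m)"
    using set_bounded_m_cycles_eq[of a b c d m] finite_set by metis
next
  let ?L = "\<lambda>b d m. let B = Suc (cycle_bound b d m) in bounded_m_cycles b d m B (Suc B * B)"
  have "recfun 5 (\<lambda>xs. list_encode (map list_encode (?L (xs ! 1) (xs ! 3) (xs ! 4))))"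
    unfolding Let_def cycle_bound_def
    by (intro recfun_bounded_m_cycles; intro recfun_intros; simp)
  then obtain q where q: "\<And>xs. length xs = 5 \<Longrightarrow>
      rec_eval q xs (list_encode (map list_encode (?L (xs ! 1) (xs ! 3) (xs ! 4))))"
    unfolding recfun_def by blast
  show "\<exists>algorithm :: recf. \<forall>a b c d m :: nat.
      0 < a \<and> 1 < b \<and> 0 < c \<and> 1 < d \<and> a * (b - 1) = c * (d - 1) \<and> 0 < m \<longrightarrow>
        (\<exists>L :: nat list list.
          rec_eval algorithm [a, b, c, d, m] (list_encode (map list_encode L)) \<and>
          set L = m_cycles (P_map a b c d) m)"
  proof (intro exI[of _ q] allI impI)
    fix a b c d m :: nat
    assume A: "0 < a \<and> 1 < b \<and> 0 < c \<and> 1 < d \<and> a * (b - 1) = c * (d - 1) \<and> 0 < m"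
    have "[a, b, c, d, m] ! 1 = b" "[a, b, c, d, m] ! 3 = d" "[a, b, c, d, m] ! 4 = m"
      by (simp_all add: numeral_eq_Suc)
    then have "rec_eval q [a, b, c, d, m] (list_encode (map list_encode (?L b d m)))"
      using q[of "[a, b, c, d, m]"] by simp
    moreover have "set (?L b d m) = m_cycles (P_map a b c d) m"
      using set_bounded_m_cycles_eq[of a b c d m] A by (simp add: Let_def)
    ultimately show "\<exists>L :: nat list list.
          rec_eval q [a, b, c, d, m] (list_encode (map list_encode L)) \<and>
          set L = m_cycles (P_map a b c d) m" by blast
  qed
qed

end
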